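(* Let $n\ge 3$, $0<m<\frac{n-2}{n}$, $\beta>\beta_0(m)$ and $\alpha=\frac{2\beta+1}{1-m}$. For any $\lambda>0$ let $f_\lambda$ be the unique radially symmetric solution of $$\Delta f^m+\alpha f+\beta\, y\cdot\nabla f=0,\quad f>0\ \text{ in }\mathbb{R}^n,\qquad f(0)=\lambda^{\frac{2}{1-m}},$$ written as $f_\lambda(r)$, $r=|y|$. Then the following holds. (a) If either (i) $n\ge 3$, $0<m<\frac{n-2}{n}$ and $\beta>\beta_1(m)$, or (ii) $n>4$, $0<m<\frac{n-4}{n-2}$ and $\beta_0(m)<\beta\le\beta_1(m)$, then $$f_{\lambda_1}(r)<f_{\lambda_2}(r)\qquad\forall r\ge 0,\ \lambda_2>\lambda_1>0,$$ and moreover $f_{\lambda_1}-f_{\lambda_2}\notin L^1(\mathbb{R}^n)$ for all $\lambda_2>\lambda_1>0$. (b) If either (i) $3\le n\le 4$, $0<m<\frac{n-2}{n}$ and $\beta_0(m)<\beta<\beta_1(m)$, or (ii) $n>4$, $\frac{n-4}{n-2}<m<\frac{n-2}{n}$ and $\beta_0(m)<\beta<\beta_1(m)$, then there exists a constant $R_0>0$ such that $$f_{\lambda_1}(r)>f_{\lambda_2}(r)\qquad\forall r\ge R_0/\lambda_1,\ \lambda_2>\lambda_1>0,$$ and moreover $f_{\lambda_1}-f_{\lambda_2}\in L^1(\mathbb{R}^n)$ for all $\lambda_2>\lambda_1>0$. (c) If either (i) $3\le n\le 4$, $0<m<\frac{n-2}{n}$ and $\beta=\beta_1(m)$, or (ii)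 $n>4$, $\frac{n-4}{n-2}<m<\frac{n-2}{n}$ and $\beta=\beta_1(m)$, then $f_{\lambda_1}(r)<f_{\lambda_2}(r)$ for all $r\ge0$ and $\lambda_2>\lambda_1>0$, and $f_{\lambda_1}-f_{\lambda_2}\in L^1(\mathbb{R}^n)$ for all $\lambda_2>\lambda_1>0$.
   Context: For $n\ge3$ and $0<m<\frac{n-2}{n}$ define $$\beta_1(m)=\frac{1}{n-2-nm},\quad \beta_e(m)=\frac{m}{n-2-nm},\quad \beta_2(m)=\sqrt{\frac{2(1-m)}{n-2-nm}}+\frac{(n+2)m-(n-2)}{2(n-2-nm)},$$ $$\beta_0(m)=\max(\beta_2(m),\beta_e(m)).$$ For $\beta\ge\beta_e(m)$ and $\alpha=\frac{2\beta+1}{1-m}$, existence and uniqueness of the radially symmetric solution $f_\lambda$ of the elliptic problem is a known result for every $\lambda>0$. *)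

theory Defs
  imports "HOL-Analysis.Analysis"
begin

definition partial_deriv :: "'a::euclidean_space \<Rightarrow> ('a \<Rightarrow> real) \<Rightarrow> 'a \<Rightarrow> real" where
  "partial_deriv b u x = deriv (\<lambda>t. u (x + t *\<^sub>R b)) 0"

definition grad :: "('a::euclidean_space \<Rightarrow> real) \<Rightarrow> 'a \<Rightarrow> 'a" where
  "grad u x = (\<Sum>b\<in>Basis. partial_deriv b u x *\<^sub>R b)"

definition laplacian :: "('a::euclidean_space \<Rightarrow> real) \<Rightarrow> 'a \<Rightarrow> real" where
  "laplacian u x = (\<Sum>b\<in>Basis. partial_deriv b (partial_deriv b u) x)"

definition C1_fun :: "('a::euclidean_space \<Rightarrow> real) \<Rightarrow> bool" where
  "C1_fun u \<longleftrightarrow> (\<forall>x. u differentiable (at x)) \<and>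
     (\<forall>b\<in>Basis. continuous_on UNIV (partial_deriv b u))"

definition C2_fun :: "('a::euclidean_space \<Rightarrow> real) \<Rightarrow> bool" where
  "C2_fun u \<longleftrightarrow> C1_fun u \<and> (\<forall>b\<in>Basis. C1_fun (partial_deriv b u))"

(* "Solution" means classical positive solution on the whole space. The C2 requirement also
   guarantees that the values of deriv used in laplacian and grad are genuine derivatives;
   since u > 0, it is equivalent to require it of u or of u powr m. *)
definition elliptic_solution ::
  "real \<Rightarrow> real \<Rightarrow> real \<Rightarrow> ('a::euclidean_space \<Rightarrow> real) \<Rightarrow> bool" where
  "elliptic_solution m \<alpha> \<beta> u \<longleftrightarrow>
     C2_fun u \<and> (\<forall>y. 0 < u y) \<and>
     (\<forall>y. laplacian (\<lambda>z. u z powr m) y + \<alpha> * u y + \<beta> * (y \<bullet> grad u y) = 0)"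

definition beta1 :: "nat \<Rightarrow> real \<Rightarrow> real" where
  "beta1 n m = 1 / (real n - 2 - real n * m)"

definition beta_e :: "nat \<Rightarrow> real \<Rightarrow> real" where
  "beta_e n m = m / (real n - 2 - real n * m)"

definition beta2 :: "nat \<Rightarrow> real \<Rightarrow> real" where
  "beta2 n m = sqrt (2 * (1 - m) / (real n - 2 - real n * m))
     + ((real n + 2) * m - (real n - 2)) / (2 * (real n - 2 - real n * m))"

definition beta0 :: "nat \<Rightarrow> real \<Rightarrow> real" where
  "beta0 n m = max (beta2 n m) (beta_e n m)"

end

theory Submission
  imports Defs
begin

text \<open>By uniqueness for the radial ODE, \<open>f\<^sub>\<lambda>(r) = \<lambda>\<^bsup>2/(1-m)\<^esup> f\<^sub>1(\<lambda> r)\<close>, so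
  \<open>r\<^sup>2 f\<^sub>\<lambda>\<^bsup>1-m\<^esup>\<close> as a function of \<open>s = ln r\<close> is a translate by \<open>ln \<lambda>\<close> of a single trajectory,
  and the comparison of \<open>f\<^sub>\<lambda>\<close> for different \<open>\<lambda>\<close> is the monotonicity of that trajectory. With
  \<open>u\<close> the logarithm of \<open>r\<^sup>2 f\<^bsup>1-m\<^esup>\<close> normalised at its equilibrium and \<open>X = u'\<close>, the Barenblatt
  solution (\<open>\<beta> = \<beta>\<^sub>1\<close>) is the curve \<open>X = 2 (1 - exp u)\<close>, which the flow crosses in one direction
  for \<open>\<beta> > \<beta>\<^sub>1\<close> and in the other for \<open>\<beta> < \<beta>\<^sub>1\<close>. The condition \<open>\<beta> > \<beta>\<^sub>2\<close> says that the equilibrium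
  \<open>u = 0\<close> is a node; then \<open>X = \<theta> (1 - exp u)\<close>, with \<open>\<theta>\<close> the geometric mean of the two decay rates,
  is a barrier. The rate of the Barenblatt solution is 2, and it is the slow or the fast direction of
  the node according to \<open>m\<close> being below or above \<open>(n-4)/(n-2)\<close>; in the second case a trajectory
  with \<open>\<beta> < \<beta>\<^sub>1\<close> stays above the Barenblatt curve, is too steep to converge to the node
  from below, and overshoots exactly once.

  Integrability follows from the mass identity
  \<open>r\<^bsup>n-1\<^esup> (f\<^sup>m)' + \<beta> r\<^sup>n f = - (\<alpha> - n \<beta>) \<integral>\<^sub>0\<^sup>r \<rho>\<^bsup>n-1\<^esup> f d\<rho>\<close> for the difference of two solutions:
  where the difference has a sign, the right-hand side has a limit in \<open>[-\<infinity>, \<infinity>]\<close>, and a nonzero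
  limit forces a logarithmic divergence on the left if the difference is integrable.\<close>

section \<open>First zeros and monotonicity from derivatives\<close>

lemma first_exit:
  fixes Y :: "real \<Rightarrow> real"
  assumes cont: "continuous_on {s0..t1} Y" and pos: "Y s0 > 0" and neg: "Y t1 \<le> 0" and le: "s0 \<le> t1"
  obtains t where "s0 < t" "t \<le> t1" "Y t = 0" "\<And>s. s0 \<le> s \<Longrightarrow> s < t \<Longrightarrow> Y s > 0"
proof -
  define S where "S = {s \<in> {s0..t1}. Y s = 0}"
  have "\<exists>x\<ge>s0. x \<le> t1 \<and> Y x = 0"
    using IVT2'[of Y t1 0 s0] cont pos neg le by auto
  then have ne: "S \<noteq> {}" by (auto simp: S_def)
  have "compact S" unfolding S_def
    using continuous_closed_preimage_constant[OF cont, of 0]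
      bounded_subset[OF bounded_closed_interval[of s0 t1], of "{s \<in> {s0..t1}. Y s = 0}"]
    by (simp add: compact_eq_bounded_closed subset_eq)
  then obtain t where t: "t \<in> S" "\<And>s. s \<in> S \<Longrightarrow> t \<le> s"
    using compact_attains_inf ne by metis
  show thesis
  proof
    show "s0 < t" using t(1) pos by (cases "t = s0") (auto simp: S_def)
    show "t \<le> t1" "Y t = 0" using t(1) by (auto simp: S_def)
    fix s assume s: "s0 \<le> s" "s < t"
    show "Y s > 0"
    proof (rule ccontr)
      assume "\<not> Y s > 0"
      then have "\<exists>x\<ge>s0. x \<le> s \<and> Y x = 0"
        using IVT2'[of Y s 0 s0] continuous_on_subset[OF cont, of "{s0..s}"] pos s \<open>t \<le> t1\<close> by auto
      then obtain x where "s0 \<le> x" "x \<le> s" "Y x = 0" by auto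
      then have "x \<in> S" using s \<open>t \<le> t1\<close> by (auto simp: S_def)
      with t(2) \<open>x \<le> s\<close> s show False by force
    qed
  qed
qed

lemma first_zero_deriv_nonpos:
  fixes Y :: "real \<Rightarrow> real"
  assumes "(Y has_real_derivative D) (at t)" "s0 < t" "Y t = 0" "\<And>s. s0 \<le> s \<Longrightarrow> s < t \<Longrightarrow> Y s > 0"
  shows "D \<le> 0"
proof (rule ccontr)
  assume "\<not> D \<le> 0"
  then obtain e where e: "e > 0" "\<And>h. h > 0 \<Longrightarrow> h < e \<Longrightarrow> Y (t - h) < Y t"
    using DERIV_pos_inc_left[OF assms(1)] by auto
  define h where "h = min (e/2) (t - s0)"
  have "h > 0" "h < e" "h \<le> t - s0" using e assms(2) by (auto simp: h_def)
  then show False using e(2)[of h] assms(3) assms(4)[of "t - h"] by auto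
qed

lemma deriv_nonneg_mono:
  fixes F :: "real \<Rightarrow> real"
  assumes "a \<le> c" "\<And>x. a \<le> x \<Longrightarrow> x \<le> c \<Longrightarrow> (F has_real_derivative F' x) (at x)"
    "\<And>x. a < x \<Longrightarrow> x < c \<Longrightarrow> F' x \<ge> 0"
  shows "F a \<le> F c"
proof (cases "a = c")
  case False
  then obtain z where "a < z" "z < c" "F c - F a = (c - a) * F' z"
    using MVT2[of a c F F'] assms by auto
  moreover have "0 \<le> (c - a) * F' z"
    using assms(3)[of z] calculation assms(1) by simp
  ultimately show ?thesis by linarith
qed simp

lemma deriv_pos_less:
  fixes F :: "real \<Rightarrow> real"
  assumes "a < c" "\<And>x. a \<le> x \<Longrightarrow> x \<le> c \<Longrightarrow> (F has_real_derivative F' x) (at x)"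
    "\<And>x. a < x \<Longrightarrow> x < c \<Longrightarrow> F' x > 0"
  shows "F a < F c"
proof -
  obtain z where "a < z" "z < c" "F c - F a = (c - a) * F' z"
    using MVT2[of a c F F'] assms by auto
  moreover have "0 < (c - a) * F' z"
    using assms(3)[of z] calculation assms(1) by simp
  ultimately show ?thesis by linarith
qed

text \<open>Monotonicity and the limit give only \<open>P (t - 1) \<ge> 0\<close>; the remaining
  unit interval supplies strictness.\<close>

lemma at_bot_zero_deriv_pos:
  fixes P :: "real \<Rightarrow> real"
  assumes lim: "(P \<longlongrightarrow> 0) at_bot" and d: "\<And>s. s \<le> t \<Longrightarrow> (P has_real_derivative P' s) (at s)"
    and pos: "\<And>s. s < t \<Longrightarrow> P' s > 0"
  shows "P t > 0"
proof -
  have "P (t - 1) \<ge> 0"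
  proof (rule tendsto_upperbound[OF lim])
    show "\<forall>\<^sub>F s in at_bot. P s \<le> P (t - 1)"
      unfolding eventually_at_bot_linorder
    proof (intro exI allI impI)
      fix s assume "s \<le> t - 1"
      then show "P s \<le> P (t - 1)"
        using deriv_nonneg_mono[of s "t - 1" P P'] d pos by (smt (verit))
    qed
  qed simp
  moreover have "P (t - 1) < P t" using deriv_pos_less[of "t - 1" t P P'] d pos by auto
  ultimately show ?thesis by simp
qed

section \<open>The autonomous equation in logarithmic variables\<close>

text \<open>Here \<open>X - 2 + 2 exp u\<close> vanishes along the Barenblatt trajectory, which is the case
  \<open>b = p + 2\<close>.\<close>

locale lienard =
  fixes p d b :: real and u X :: "real \<Rightarrow> real"
  assumes p_pos: "p > 0" and d_pos: "d > 0"
    and du: "\<And>s. (u has_real_derivative X s) (at s)"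
    and dX: "\<And>s. (X has_real_derivative
      - (p/2) * (X s)\<^sup>2 - (d - p + b * exp (u s)) * X s - 2 * d * (exp (u s) - 1)) (at s)"
    and X_lim: "(X \<longlongrightarrow> 2) at_bot" and u_lim: "filterlim u at_bot at_bot"
begin

text \<open>The exponential weight is an integrating factor: in the derivative of \<open>P\<close>
  all terms cancel except one with the factor \<open>(p + 2 - b) * X\<close>. So \<open>P\<close> is
  monotone while \<open>X > 0\<close> and a first integral if \<open>b = p + 2\<close>; its sign
  tells on which side of the Barenblatt curve the trajectory lies.\<close>

definition P :: "real \<Rightarrow> real" where
  "P s = (X s + 2 * (exp (u s) - 1)) * exp (p / 2 * u s + d * s)"

lemma dP: "(P has_real_derivative exp (p / 2 * u s + d * s) * ((p + 2 - b) * exp (u s) * X s)) (at s)"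
  unfolding P_def
  by (rule derivative_eq_intros du dX refl)+ (simp add: field_simps power2_eq_square)

lemma cont_u: "continuous_on S u" and cont_X: "continuous_on S X"
  using du dX by (meson DERIV_isCont continuous_at_imp_continuous_on)+

lemma exp_u_lim: "((\<lambda>s. exp (u s)) \<longlongrightarrow> 0) at_bot"
  by (rule filterlim_compose[OF exp_at_bot u_lim])

lemma P_lim: "(P \<longlongrightarrow> 0) at_bot"
proof -
  have "filterlim (\<lambda>s. p / 2 * u s) at_bot at_bot"
    by (rule filterlim_tendsto_pos_mult_at_bot[OF tendsto_const _ u_lim]) (use p_pos in simp)
  moreover have "filterlim (\<lambda>s. d * s) at_bot at_bot"
    by (rule filterlim_tendsto_pos_mult_at_bot[OF tendsto_const d_pos filterlim_ident])
  ultimately have "filterlim (\<lambda>s. - (p / 2 * u s) + - (d * s)) at_top at_bot"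
    by (intro filterlim_at_top_add_at_top) (simp_all only: filterlim_uminus_at_bot)
  then have "filterlim (\<lambda>s. p / 2 * u s + d * s) at_bot at_bot"
    by (simp only: filterlim_uminus_at_bot minus_add_distrib)
  then have "((\<lambda>s. exp (p / 2 * u s + d * s)) \<longlongrightarrow> 0) at_bot"
    by (rule filterlim_compose[OF exp_at_bot])
  from tendsto_mult[OF tendsto_add[OF X_lim tendsto_mult[OF tendsto_const[of 2] tendsto_diff[OF exp_u_lim tendsto_const[of 1]]]] this]
  show ?thesis unfolding P_def by simp
qed

lemma start: obtains s0 where "\<And>s. s \<le> s0 \<Longrightarrow> X s > 0 \<and> u s < 0"
proof -
  have "\<forall>\<^sub>F s in at_bot. X s > 0 \<and> u s < 0"
    using order_tendstoD(1)[OF X_lim, of 0] filterlim_at_bot_dense[of u at_bot] u_lim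
    by (auto intro: eventually_conj)
  then show thesis using that by (auto simp: eventually_at_bot_linorder)
qed

text \<open>Below the equilibrium the restoring term pushes upwards: at a zero of \<open>X\<close>
  with \<open>u < 0\<close> the derivative of \<open>X\<close> is
  \<open>- 2 * d * (exp u - 1) > 0\<close>, so \<open>X\<close> cannot arrive there from positive
  values.\<close>

lemma X_pos:
  assumes "\<And>s. s < t \<Longrightarrow> u s < 0" "s < t"
  shows "X s > 0"
proof (rule ccontr)
  assume neg: "\<not> X s > 0"
  obtain s0 where s0: "\<And>s. s \<le> s0 \<Longrightarrow> X s > 0 \<and> u s < 0" using start by blast
  then have "s0 < s" using neg not_le by blast
  then obtain t' where t': "s0 < t'" "t' \<le> s" "X t' = 0" "\<And>s. s0 \<le> s \<Longrightarrow> s < t' \<Longrightarrow> X s > 0"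
    using first_exit[of s0 s X] cont_X s0[of s0] neg by (smt (verit))
  from first_zero_deriv_nonpos[OF dX t'(1,3,4)]
  have "u t' \<ge> 0" using t'(3) d_pos by (simp add: zero_le_mult_iff)
  then show False using assms(1)[of t'] assms(2) t'(2) by linarith
qed

lemma P_pos:
  assumes "\<And>s. s < t \<Longrightarrow> X s > 0" "b < p + 2"
  shows "X t + 2 * (exp (u t) - 1) > 0"
proof -
  have "P t > 0"
    by (rule at_bot_zero_deriv_pos[OF P_lim dP]) (use assms in auto)
  then show ?thesis by (simp add: P_def zero_less_mult_iff)
qed

lemma P_neg:
  assumes "\<And>s. s < t \<Longrightarrow> X s > 0" "b > p + 2"
  shows "X t + 2 * (exp (u t) - 1) < 0"
proof -
  have "- P t > 0"
    by (rule at_bot_zero_deriv_pos[where P="\<lambda>s. - P s", OF _ DERIV_minus[OF dP]])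
      (use P_lim assms tendsto_minus[OF P_lim] in \<open>auto simp: mult_less_0_iff zero_less_mult_iff\<close>)
  then show ?thesis by (simp add: P_def mult_less_0_iff)
qed

section \<open>Barriers and the monotone regimes\<close>

text \<open>The region between the axis \<open>X = 0\<close> and the curve
  \<open>X = th * (1 - exp u)\<close>, left of \<open>u = 0\<close>, is forward invariant. On the
  curve, with \<open>E = exp u - 1\<close>, the derivative of the gap \<open>Z\<close> is
  \<open>E\<close> times the expression in \<open>bar\<close>, so \<open>bar\<close> says that the
  flow points inwards.\<close>

lemma trap_below:
  assumes th: "th > 0" and init: "X s0 > 0" "u s0 < 0" "X s0 < - th * (exp (u s0) - 1)"
    and bar: "\<And>E. - 1 < E \<Longrightarrow> E < 0 \<Longrightarrow>
      th\<^sup>2 - (d - p + b) * th + 2 * d + E * th * ((1 + p/2) * th - b) < 0"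
    and s: "s0 \<le> s"
  shows "X s > 0 \<and> u s < 0"
proof (rule ccontr)
  assume neg: "\<not> (X s > 0 \<and> u s < 0)"
  define Z where "Z s = - th * (exp (u s) - 1) - X s" for s
  define Y where "Y s = min (min (X s) (Z s)) (- u s)" for s
  have "continuous_on {s0..s} Y" unfolding Y_def Z_def
    by (intro continuous_intros cont_X cont_u)
  moreover have "Y s0 > 0" using init by (simp add: Y_def Z_def)
  moreover have "Y s \<le> 0" using neg unfolding Y_def by linarith
  ultimately obtain t where t: "s0 < t" "Y t = 0" "\<And>s. s0 \<le> s \<Longrightarrow> s < t \<Longrightarrow> Y s > 0"
    using first_exit[of s0 s Y thesis] s by blast
  have before: "X s > 0" "Z s > 0" "u s < 0" if "s0 \<le> s" "s < t" for s
    using t(3)[OF that] by (auto simp: Y_def)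
  \<comment> \<open>The corner \<open>u = 0\<close> is out of reach in finite time: below the curve
    \<open>(exp (- u) - 1) * exp (th * s)\<close> does not decrease, so it stays positive.\<close>
  have ut: "u t < 0"
  proof (rule ccontr)
    assume "\<not> u t < 0"
    then have "u t = 0" using t(2) by (auto simp: Y_def)
    let ?F = "\<lambda>s. (exp (- u s) - 1) * exp (th * s)"
    have "?F s0 \<le> ?F t"
    proof (rule deriv_nonneg_mono[where F="?F"])
      show "s0 \<le> t" using t by simp
      show "(?F has_real_derivative exp (th * s) * exp (- u s) * Z s) (at s)" for s
        unfolding Z_def
        by (rule derivative_eq_intros du dX refl)+ (simp add: exp_minus field_simps)
      show "0 \<le> exp (th * s) * exp (- u s) * Z s" if "s0 < s" "s < t" for s
        using before(2)[of s] that by simp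
    qed
    moreover have "?F s0 > 0" using init(2) by simp
    ultimately show False using \<open>u t = 0\<close> by simp
  qed
  have "X t \<noteq> 0"
  proof
    assume "X t = 0"
    from first_zero_deriv_nonpos[OF dX t(1) this before(1)] \<open>X t = 0\<close>
    have "u t \<ge> 0" using d_pos by (simp add: zero_le_mult_iff)
    then show False using ut by linarith
  qed
  then have Xt: "X t > 0" and "Z t = 0" using t(2) ut by (auto simp: Y_def)
  have dZ: "(Z has_real_derivative - th * (exp (u t) * X t)
      - (- (p/2) * (X t)\<^sup>2 - (d - p + b * exp (u t)) * X t - 2 * d * (exp (u t) - 1))) (at t)"
    unfolding Z_def[abs_def] by (rule derivative_eq_intros du dX refl)+ simp
  define E where "E = exp (u t) - 1"
  have XE: "X t = - th * E" "exp (u t) = 1 + E" using \<open>Z t = 0\<close> by (auto simp: Z_def E_def)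
  have E: "-1 < E" "E < 0" using ut by (auto simp: E_def)
  have "E * (th\<^sup>2 - (d - p + b) * th + 2 * d + E * th * ((1 + p/2) * th - b)) \<le> 0"
    using first_zero_deriv_nonpos[OF dZ t(1) \<open>Z t = 0\<close> before(2)]
    unfolding XE by (simp add: algebra_simps power2_eq_square)
  then show False using bar[OF E] E mult_neg_neg by fastforce
qed

text \<open>The Barenblatt curve itself serves as the barrier (\<open>th = 2\<close>): the
  trajectory lies below it by \<open>P_neg\<close>, and the expression in \<open>bar\<close> equals
  \<open>2 * (1 + E) * (p + 2 - b)\<close>.\<close>

lemma monotone_of_b_large:
  assumes "b > p + 2"
  shows "X s > 0 \<and> u s < 0"
proof -
  obtain s0 where s0: "\<And>s. s \<le> s0 \<Longrightarrow> X s > 0 \<and> u s < 0" using start by blast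
  show ?thesis
  proof (cases "s \<le> s0")
    case False
    show ?thesis
    proof (rule trap_below[of 2 s0])
      show "X s0 < - 2 * (exp (u s0) - 1)" using P_neg[of s0] s0 assms by auto
      fix E :: real assume "-1 < E" "E < 0"
      then have "(1 + E) * (p + 2 - b) < 0" using assms by (simp add: mult_less_0_iff)
      then show "2\<^sup>2 - (d - p + b) * 2 + 2 * d + E * 2 * ((1 + p / 2) * 2 - b) < 0"
        by (simp add: algebra_simps)
    qed (use s0[of s0] False in auto)
  qed (use s0 in auto)
qed

lemma sqrt_2d: "sqrt (2 * d) > 0" "sqrt (2 * d) * sqrt (2 * d) = 2 * d"
  using d_pos by auto

text \<open>The linearisation at the equilibrium has decay rates with sum \<open>d - p + b\<close>
  and product \<open>2 * d\<close>; \<open>th\<close> is their geometric mean. At minus infinity the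
  barrier tends to \<open>th > 2\<close> and \<open>X\<close> to 2, so the trajectory starts below
  the barrier.\<close>

lemma monotone_of_d_large:
  assumes d2: "d > 2" and disc: "d - p + b > 2 * sqrt (2 * d)"
  shows "X s > 0 \<and> u s < 0"
proof -
  define th where "th = sqrt (2 * d)"
  have th: "th > 2" unfolding th_def by (rule real_less_rsqrt) (use d2 in simp)
  have d_eq: "d = th * th / 2" using sqrt_2d by (simp add: th_def)
  have "((\<lambda>s. - th * (exp (u s) - 1) - X s) \<longlongrightarrow> - th * (0 - 1) - 2) at_bot"
    by (intro tendsto_intros exp_u_lim X_lim)
  from order_tendstoD(1)[OF this, of 0] th
  obtain s1 where s1: "\<And>s. s \<le> s1 \<Longrightarrow> X s < - th * (exp (u s) - 1)"
    by (auto simp: eventually_at_bot_linorder)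
  obtain s2 where s2: "\<And>s. s \<le> s2 \<Longrightarrow> X s > 0 \<and> u s < 0" using start by blast
  define s0 where "s0 = min s1 s2"
  show ?thesis
  proof (cases "s \<le> s0")
    case False
    show ?thesis
    proof (rule trap_below[of th s0])
      fix E :: real assume E: "-1 < E" "E < 0"
      \<comment> \<open>The expression in \<open>bar\<close> is affine in \<open>E\<close>, hence
        the convex combination of its values at \<open>E = 0\<close>, negative by
        \<open>disc\<close>, and at \<open>E = -1\<close>, negative by
        \<open>th > 2\<close>.\<close>
      have "d - p + b - 2 * th > 0" using disc by (simp add: th_def)
      then have "0 < (1 + E) * (th * (d - p + b - 2 * th))"
        using E th by (intro mult_pos_pos) auto
      moreover have "0 < - E * ((th - 2) * (p / 2 * th + d))"
        using E th p_pos d_pos by (intro mult_pos_pos add_pos_pos) auto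
      moreover have "th\<^sup>2 - (d - p + b) * th + 2 * d + E * th * ((1 + p / 2) * th - b)
          = - ((1 + E) * (th * (d - p + b - 2 * th))) - (- E * ((th - 2) * (p / 2 * th + d)))"
        using d_eq by (simp add: field_simps power2_eq_square)
      ultimately show "th\<^sup>2 - (d - p + b) * th + 2 * d + E * th * ((1 + p / 2) * th - b) < 0"
        by argo
    qed (use s1[of s0] s2[of s0] th False in \<open>auto simp: s0_def\<close>)
  qed (use s2 in \<open>auto simp: s0_def\<close>)
qed

text \<open>\<open>P\<close> is constant with limit 0, so the trajectory is the Barenblatt curve, on
  which \<open>u\<close> has derivative \<open>2 * (1 - exp u)\<close>. This separable equation has
  the first integral \<open>(exp (- u) - 1) * exp (2 * s)\<close>, from which \<open>u\<close> is
  read off.\<close>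

lemma explicit_of_b_eq:
  assumes "b = p + 2"
  shows "X s > 0 \<and> u s < 0" and "(u \<longlongrightarrow> 0) at_top"
proof -
  have "(P has_real_derivative 0) (at s)" for s using dP[of s] assms by simp
  then have Pc: "P s = P 0" for s by (intro DERIV_isconst_all[of P s 0]) blast
  then obtain c where c: "P = (\<lambda>_. c)" by blast
  have "((\<lambda>_::real. c) \<longlongrightarrow> 0) at_bot" using P_lim unfolding c .
  then have "P s = 0" for s by (simp add: c tendsto_const_iff)
  then have P0: "X s + 2 * (exp (u s) - 1) = 0" for s
    by (metis P_def exp_not_eq_zero mult_eq_0_iff)
  have Xu: "X s = - 2 * (exp (u s) - 1)" for s
    using P0[of s] by linarith
  let ?F = "\<lambda>s. (exp (- u s) - 1) * exp (2 * s)"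
  have "(?F has_real_derivative 0) (at s)" for s
    by (rule derivative_eq_intros du refl)+ (simp add: Xu exp_minus field_simps)
  then have F: "?F s = ?F 0" for s
    using DERIV_isconst_all[of ?F s 0] by blast
  obtain s0 where "\<And>s. s \<le> s0 \<Longrightarrow> X s > 0 \<and> u s < 0" using start by blast
  then have "?F s0 > 0" by simp
  then have "?F s > 0" for s using F[of s0] F[of s] by simp
  then have neg: "u s < 0" for s by (simp add: zero_less_mult_iff)
  then show "X s > 0 \<and> u s < 0" using Xu[of s] by simp
  have "exp (- u s) = 1 + ?F 0 * exp (- (2 * s))" for s
    using F[of s] by (simp add: exp_minus field_simps)
  then have u_eq: "u s = - ln (1 + ?F 0 * exp (- (2 * s)))" for s
    by (metis ln_exp minus_minus)
  have "filterlim (\<lambda>s::real. (-2) * s) at_bot at_top"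
    by (rule filterlim_tendsto_neg_mult_at_bot[OF tendsto_const _ filterlim_ident]) simp
  then have "filterlim (\<lambda>s::real. - (2 * s)) at_bot at_top" by simp
  then have "((\<lambda>s. - ln (1 + ?F 0 * exp (- (2 * s)))) \<longlongrightarrow> - ln (1 + ?F 0 * 0)) at_top"
    by (intro tendsto_intros filterlim_compose[OF exp_at_bot]) simp_all
  then show "(u \<longlongrightarrow> 0) at_top" unfolding u_eq[abs_def, symmetric] by simp
qed

section \<open>Overshooting the equilibrium\<close>

text \<open>Two incompatible decay rates: if \<open>u\<close> stayed negative, the growth of
  \<open>P\<close> would bound \<open>X\<close>, hence \<open>- u\<close>, from below by a multiple
  of \<open>exp (- d * s)\<close>, while lying above the Barenblatt curve bounds \<open>- u\<close>
  from above by a multiple of \<open>exp (- 2 * s)\<close>. For \<open>d < 2\<close> this fails at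
  large \<open>s\<close>.\<close>

lemma crossing:
  assumes "b < p + 2" "d < 2"
  shows "\<exists>s. u s \<ge> 0"
proof (rule ccontr)
  assume "\<not> ?thesis"
  then have neg: "u s < 0" for s by (simp add: not_le)
  then have Xp: "X s > 0" for s using X_pos[of "s + 1" s] by simp
  then have M: "X s + 2 * (exp (u s) - 1) > 0" for s using P_pos assms by blast
  then have P0: "P 0 > 0" by (simp add: P_def)
  have X_ge: "X s \<ge> P 0 * exp (- d * s)" if "s \<ge> 0" for s
  proof -
    have "P 0 \<le> P s"
      by (rule deriv_nonneg_mono[OF that dP]) (use assms Xp in \<open>auto intro!: mult_nonneg_nonneg less_imp_le\<close>)
    also have "P s \<le> (X s + 2 * (exp (u s) - 1)) * exp (d * s)"
      unfolding P_def using M[of s] neg[of s] p_pos by (intro mult_left_mono) (auto simp: mult_le_0_iff)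
    also have "\<dots> \<le> X s * exp (d * s)"
      using neg[of s] by (intro mult_right_mono) auto
    finally show ?thesis by (simp add: exp_minus field_simps)
  qed
  \<comment> \<open>The bound on \<open>X\<close> is integrated up to infinity: the left side is
    nondecreasing in \<open>s\<close>, and at a later time \<open>t\<close> it is at most
    \<open>P 0 / d * exp (- d * t)\<close>, which tends to 0.\<close>
  have u_le: "u s + P 0 / d * exp (- d * s) \<le> 0" if "s \<ge> 0" for s
  proof (rule tendsto_lowerbound)
    have "filterlim (\<lambda>s. - d * s) at_bot at_top"
      by (rule filterlim_tendsto_neg_mult_at_bot[OF tendsto_const _ filterlim_ident]) (use d_pos in simp)
    then have "((\<lambda>s. P 0 / d * exp (- d * s)) \<longlongrightarrow> P 0 / d * 0) at_top"
      by (intro tendsto_intros filterlim_compose[OF exp_at_bot])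
    then show "((\<lambda>s. P 0 / d * exp (- d * s)) \<longlongrightarrow> 0) at_top" by simp
    show "\<forall>\<^sub>F t in at_top. u s + P 0 / d * exp (- d * s) \<le> P 0 / d * exp (- d * t)"
      unfolding eventually_at_top_linorder
    proof (intro exI allI impI)
      fix t assume "s \<le> t"
      have "u s + P 0 / d * exp (- d * s) \<le> u t + P 0 / d * exp (- d * t)"
      proof (rule deriv_nonneg_mono[where F="\<lambda>s. u s + P 0 / d * exp (- d * s)", OF \<open>s \<le> t\<close>])
        show "((\<lambda>s. u s + P 0 / d * exp (- d * s)) has_real_derivative X x - P 0 * exp (- d * x)) (at x)" for x
          by (rule derivative_eq_intros du refl)+ (use d_pos in simp)
        show "0 \<le> X x - P 0 * exp (- d * x)" if "s < x" for x
          using X_ge[of x] that \<open>s \<ge> 0\<close> by simp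
      qed
      then show "u s + P 0 / d * exp (- d * s) \<le> P 0 / d * exp (- d * t)" using neg[of t] by simp
    qed
  qed simp
  define C where "C = exp (- u 0) - 1"
  \<comment> \<open>Above the Barenblatt curve, the quantity
    \<open>(exp (- u) - 1) * exp (2 * s)\<close> that is conserved on the curve does not
    increase.\<close>
  have u_ge: "- u s \<le> C * exp (- 2 * s)" if "s \<ge> 0" for s
  proof -
    have "- ((exp (- u 0) - 1) * exp (2 * 0)) \<le> - ((exp (- u s) - 1) * exp (2 * s))"
    proof (rule deriv_nonneg_mono[where F="\<lambda>s. - ((exp (- u s) - 1) * exp (2 * s))", OF that])
      show "((\<lambda>s. - ((exp (- u s) - 1) * exp (2 * s))) has_real_derivative
          exp (2 * x) * exp (- u x) * (X x + 2 * (exp (u x) - 1))) (at x)" for x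
        by (rule derivative_eq_intros du refl)+ (simp add: exp_minus field_simps)
      show "0 \<le> exp (2 * x) * exp (- u x) * (X x + 2 * (exp (u x) - 1))" for x
        using M[of x] by (intro mult_nonneg_nonneg) auto
    qed
    then have "exp (- u s) - 1 \<le> C / exp (2 * s)"
      by (simp add: C_def pos_le_divide_eq)
    also have "C / exp (2 * s) = C * exp (- 2 * s)"
      by (simp add: exp_minus divide_inverse)
    finally have "exp (- u s) - 1 \<le> C * exp (- 2 * s)" .
    then show ?thesis using exp_ge_add_one_self[of "- u s"] by linarith
  qed
  \<comment> \<open>Chosen so that \<open>exp x \<ge> 1 + x\<close> makes
    \<open>P 0 / d * exp ((2 - d) * s)\<close> at least \<open>P 0 / d + C\<close>, more than the
    bound \<open>C\<close> allows.\<close>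
  define s where "s = C * d / (P 0 * (2 - d))"
  have "C > 0" using neg by (simp add: C_def)
  then have "s \<ge> 0" using P0 d_pos assms by (simp add: s_def)
  have "P 0 / d * exp (- d * s) \<le> C * exp (- 2 * s)"
    using u_le[OF \<open>s \<ge> 0\<close>] u_ge[OF \<open>s \<ge> 0\<close>] by linarith
  then have "P 0 / d * exp (- d * s) * exp (2 * s) \<le> C * exp (- 2 * s) * exp (2 * s)"
    by (intro mult_right_mono) auto
  moreover have "exp (- d * s) * exp (2 * s) = exp ((2 - d) * s)" "exp (- 2 * s) * exp (2 * s) = 1"
    unfolding exp_add[symmetric] by (simp_all add: algebra_simps)
  ultimately have "P 0 / d * exp ((2 - d) * s) \<le> C"
    by (simp add: mult.assoc)
  moreover have "P 0 / d * exp ((2 - d) * s) \<ge> P 0 / d * (1 + (2 - d) * s)"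
    using P0 d_pos by (intro mult_left_mono exp_ge_add_one_self) auto
  moreover have "P 0 / d * (1 + (2 - d) * s) = P 0 / d + C"
    using P0 d_pos assms by (simp add: s_def field_simps)
  ultimately show False using P0 d_pos by (smt (verit) divide_pos_pos)
qed

text \<open>The barrier on the other side of the equilibrium: where \<open>u > 0\<close>, the flow
  crosses the curve \<open>X = - th * (exp u - 1)\<close> only upwards, and above this curve
  \<open>u\<close> cannot decay to 0 in finite time.\<close>

lemma trap_above:
  assumes th: "th > 0" and init: "u s0 > 0" "X s0 + th * (exp (u s0) - 1) > 0"
    and bar: "\<And>E. E > 0 \<Longrightarrow>
      th\<^sup>2 - (d - p + b) * th + 2 * d + E * th * ((1 + p/2) * th - b) < 0"
    and s: "s0 \<le> s"
  shows "u s > 0"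
proof (rule ccontr)
  assume neg: "\<not> ?thesis"
  define Z where "Z s = X s + th * (exp (u s) - 1)" for s
  define Y where "Y s = min (Z s) (u s)" for s
  have "continuous_on {s0..s} Y" unfolding Y_def Z_def
    by (intro continuous_intros cont_X cont_u)
  moreover have "Y s0 > 0" using init by (simp add: Y_def Z_def)
  moreover have "Y s \<le> 0" using neg unfolding Y_def by linarith
  ultimately obtain t where t: "s0 < t" "Y t = 0" "\<And>s. s0 \<le> s \<Longrightarrow> s < t \<Longrightarrow> Y s > 0"
    using first_exit[of s0 s Y thesis] s by blast
  have before: "Z s > 0" "u s > 0" if "s0 \<le> s" "s < t" for s
    using t(3)[OF that] by (auto simp: Y_def)
  have ut: "u t > 0"
  proof (rule ccontr)
    assume "\<not> u t > 0"
    then have "u t = 0" using t(2) by (auto simp: Y_def)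
    let ?F = "\<lambda>s. (1 - exp (- u s)) * exp (th * s)"
    have "?F s0 \<le> ?F t"
    proof (rule deriv_nonneg_mono[where F="?F"])
      show "s0 \<le> t" using t by simp
      show "(?F has_real_derivative exp (th * s) * exp (- u s) * Z s) (at s)" for s
        unfolding Z_def
        by (rule derivative_eq_intros du dX refl)+ (simp add: exp_minus field_simps)
      show "0 \<le> exp (th * s) * exp (- u s) * Z s" if "s0 < s" "s < t" for s
        using before(1)[of s] that by simp
    qed
    moreover have "?F s0 > 0" using init(1) by simp
    ultimately show False using \<open>u t = 0\<close> by simp
  qed
  then have "Z t = 0" using t(2) by (auto simp: Y_def)
  have dZ: "(Z has_real_derivative th * (exp (u t) * X t)
      + (- (p/2) * (X t)\<^sup>2 - (d - p + b * exp (u t)) * X t - 2 * d * (exp (u t) - 1))) (at t)"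
    unfolding Z_def[abs_def] by (rule derivative_eq_intros du dX refl)+ simp
  define E where "E = exp (u t) - 1"
  have XE: "X t = - th * E" "exp (u t) = 1 + E" using \<open>Z t = 0\<close> by (auto simp: Z_def E_def)
  have E: "0 < E" using ut by (auto simp: E_def)
  have "E * (th\<^sup>2 - (d - p + b) * th + 2 * d + E * th * ((1 + p/2) * th - b)) \<ge> 0"
    using first_zero_deriv_nonpos[OF dZ t(1) \<open>Z t = 0\<close> before(1)]
    unfolding XE by (simp add: algebra_simps power2_eq_square)
  then show False using bar[OF E] E by (simp add: zero_le_mult_iff)
qed

text \<open>For \<open>d < 2\<close> the geometric mean \<open>sqrt (2 * d)\<close> of 2 and
  \<open>d\<close> exceeds \<open>d\<close>. The bound makes the damping coefficient positive where
  \<open>u \<ge> 0\<close> and returns in the integrability argument.\<close>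

lemma b_large_of_disc:
  assumes "d < 2" "d - p + b > 2 * sqrt (2 * d)"
  shows "b > p + d"
proof -
  have "d < sqrt (2 * d)" using assms(1) d_pos
    by (intro real_less_rsqrt) (simp add: power2_eq_square)
  then show ?thesis using assms(2) by linarith
qed

text \<open>The trajectory crosses \<open>u = 0\<close> at \<open>t\<close> with positive velocity
  and turns at a maximum \<open>t2\<close>. From then on the barrier of the node keeps
  \<open>u\<close> positive, and the restoring term keeps \<open>X\<close> negative.\<close>

lemma overshoot:
  assumes bp: "b < p + 2" and d2: "d < 2" and disc: "d - p + b > 2 * sqrt (2 * d)"
  shows "\<exists>s1. \<forall>s>s1. X s < 0 \<and> u s > 0"
proof -
  obtain s0 where s0: "\<And>s. s \<le> s0 \<Longrightarrow> X s > 0 \<and> u s < 0" using start by blast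
  obtain s' where s': "u s' \<ge> 0" using crossing bp d2 by blast
  then have "s0 \<le> s'" using s0[of s'] by linarith
  then obtain t where t: "s0 < t" "u t = 0" "\<And>s. s0 \<le> s \<Longrightarrow> s < t \<Longrightarrow> u s < 0"
    using first_exit[of s0 s' "\<lambda>s. - u s"] cont_u s0[of s0] s' continuous_on_minus[OF cont_u]
    by (smt (verit))
  have "u s < 0" if "s < t" for s using t(3)[of s] s0[of s] that by force
  then have "X s > 0" if "s < t" for s using X_pos that by blast
  then have Xt: "X t > 0" using P_pos[of t] bp t(2) by auto
  have b: "b > p + d" using b_large_of_disc d2 disc by blast
  have damp: "d - p + b * exp v > 0" if "v \<ge> 0" for v
  proof -
    have "b * 1 \<le> b * exp v" by (rule mult_left_mono) (use that b p_pos d_pos in auto)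
    then show ?thesis using b p_pos d_pos by linarith
  qed
  \<comment> \<open>If \<open>X\<close> stayed positive after \<open>t\<close>, then
    \<open>u\<close> would stay above \<open>u (t + 1)\<close> and the restoring term alone would
    push the derivative of \<open>X\<close> below \<open>- c\<close>, which exhausts
    \<open>X\<close> within the time \<open>X (t + 1) / c\<close>.\<close>
  obtain t2 where t2: "t < t2" "X t2 = 0" "\<And>s. t \<le> s \<Longrightarrow> s < t2 \<Longrightarrow> X s > 0"
  proof -
    have "\<exists>s\<ge>t. X s \<le> 0"
    proof (rule ccontr)
      assume "\<not> ?thesis"
      then have Xp: "X s > 0" if "s \<ge> t" for s using that not_le by blast
      have um: "u s \<le> u r" if "t \<le> s" "s \<le> r" for s r
        using deriv_nonneg_mono[OF that(2) du] Xp that by (meson less_imp_le order_trans less_le_trans)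
      have u1: "u (t + 1) > 0" using deriv_pos_less[of t "t + 1" u X] du Xp t(2) by auto
      define c where "c = 2 * d * (exp (u (t + 1)) - 1)"
      have c: "c > 0" using u1 d_pos by (simp add: c_def)
      have le: "X s + c * s \<le> X (t + 1) + c * (t + 1)" if "s \<ge> t + 1" for s
      proof -
        have "- (X (t + 1) + c * (t + 1)) \<le> - (X s + c * s)"
        proof (rule deriv_nonneg_mono[where F="\<lambda>s. - (X s + c * s)", OF that])
          show "((\<lambda>s. - (X s + c * s)) has_real_derivative
            - (- (p/2) * (X x)\<^sup>2 - (d - p + b * exp (u x)) * X x - 2 * d * (exp (u x) - 1) + c)) (at x)" for x
            by (rule derivative_eq_intros dX refl)+ simp
          fix x assume x: "t + 1 < x"
          have "u (t + 1) \<le> u x" using um x by simp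
          then have "c \<le> 2 * d * (exp (u x) - 1)" using d_pos by (simp add: c_def)
          moreover have "(d - p + b * exp (u x)) * X x \<ge> 0"
            using damp[of "u x"] Xp[of x] x u1 \<open>u (t + 1) \<le> u x\<close> by simp
          moreover have "p / 2 * (X x)\<^sup>2 \<ge> 0" using p_pos by simp
          ultimately show "0 \<le> - (- (p/2) * (X x)\<^sup>2 - (d - p + b * exp (u x)) * X x - 2 * d * (exp (u x) - 1) + c)"
            by simp
        qed
        then show ?thesis by simp
      qed
      define s where "s = t + 1 + X (t + 1) / c"
      have "s \<ge> t + 1" using c Xp[of "t + 1"] by (simp add: s_def)
      moreover have "c * s = c * (t + 1) + X (t + 1)" using c by (simp add: s_def field_simps)
      ultimately show False using le[of s] Xp[of s] by simp
    qed
    then show thesis using that first_exit[of t _ X] cont_X Xt by metis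
  qed
  have u2: "u t2 > 0" using deriv_pos_less[OF t2(1) du] t2(3) t(2) by auto
  define th where "th = sqrt (2 * d)"
  have th: "0 < th" "th < 2" "2 * d = th * th"
    using sqrt_2d by (simp_all add: th_def real_less_lsqrt d2)
  have up: "u s > 0" if "s \<ge> t2" for s
  proof (rule trap_above[OF th(1) u2 _ _ that])
    show "0 < X t2 + th * (exp (u t2) - 1)" using t2(2) u2 th by simp
    fix E :: real assume E: "E > 0"
    \<comment> \<open>By \<open>disc\<close> and \<open>th * th = 2 * d\<close>, the coefficient
      \<open>(1 + p/2) * th - b\<close> is less than \<open>- (1 - th/2) * (th + p)\<close>; so the
      part of the barrier condition linear in \<open>E\<close> is nonpositive.\<close>
    have "0 \<le> (1 - th/2) * (th + p)" using th p_pos by simp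
    moreover have disc': "2 * th < d - p + b" using disc by (simp add: th_def)
    ultimately have "(1 + p/2) * th - b \<le> 0"
      using th(3) by (simp add: algebra_simps)
    then have le: "E * th * ((1 + p/2) * th - b) \<le> 0" using E th by (intro mult_nonneg_nonpos) auto
    have less: "th * (2 * th - (d - p + b)) < 0"
      using disc' th(1) by (intro mult_pos_neg) linarith+
    have eq: "th\<^sup>2 - (d - p + b) * th + 2 * d = th * (2 * th - (d - p + b))"
      using th(3) by (simp add: algebra_simps power2_eq_square)
    show "th\<^sup>2 - (d - p + b) * th + 2 * d + E * th * ((1 + p / 2) * th - b) < 0"
      by (rule add_neg_nonpos[OF less[folded eq] le])
  qed
  have Xn: "X s < 0" if "s > t2" for s
  proof (rule ccontr)
    assume neg: "\<not> X s < 0"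
    have D0: "(X has_real_derivative - 2 * d * (exp (u t2) - 1)) (at t2)" using dX[of t2] t2(2) by simp
    have "- 2 * d * (exp (u t2) - 1) < 0" using d_pos u2 by (simp add: mult_less_0_iff)
    from DERIV_neg_dec_right[OF D0 this] obtain e
      where e: "e > 0" "\<And>h. 0 < h \<Longrightarrow> h < e \<Longrightarrow> X (t2 + h) < X t2" by auto
    define r where "r = t2 + min (e/2) (s - t2)"
    have r: "t2 < r" "r \<le> s" "X r < 0" using e(1) e(2)[of "r - t2"] that t2(2) by (auto simp: r_def)
    \<comment> \<open>A first return of \<open>X\<close> to 0 from below needs a nonnegative
      derivative of \<open>X\<close>, that is \<open>u \<le> 0\<close>, which the barrier
      excludes.\<close>
    obtain t3 where t3: "r < t3" "X t3 = 0" "\<And>s. r \<le> s \<Longrightarrow> s < t3 \<Longrightarrow> - X s > 0"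
      using first_exit[of r s "\<lambda>s. - X s"] continuous_on_minus[OF cont_X] r neg
      by (smt (verit))
    have "(u t3) \<le> 0"
      using first_zero_deriv_nonpos[OF DERIV_minus[OF dX] t3(1) _ t3(3)] t3(2) d_pos by (simp add: mult_le_0_iff)
    then show False using up[of t3] t3(1) r(1) by simp
  qed
  show ?thesis using up Xn by (intro exI[of _ t2]) auto
qed

end

section \<open>Integrability of radial functions\<close>

lemma emeasure_norm_atMost:
  "emeasure (distr lborel borel (norm :: 'a::euclidean_space \<Rightarrow> real)) {..x}
    = (if x < 0 then 0 else ennreal (unit_ball_vol (DIM('a)) * x ^ DIM('a)))"
proof -
  have "emeasure (distr lborel borel (norm :: 'a \<Rightarrow> real)) {..x} = emeasure lborel (cball (0::'a) x)"
    by (subst emeasure_distr) (auto intro!: arg_cong[where f="emeasure lborel"])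
  then show ?thesis by (simp add: emeasure_cball)
qed

text \<open>Polar coordinates for radial functions. The half-lines form an intersection-stable
  generator, and on them both measures give the volume of a ball, of which the density is the
  derivative in the radius.\<close>

lemma distr_norm_lborel:
  "distr lborel borel (norm :: 'a::euclidean_space \<Rightarrow> real) =
    density lborel (\<lambda>r. ennreal (real DIM('a) * unit_ball_vol (DIM('a)) * r ^ (DIM('a) - 1)) * indicator {0..} r)"
    (is "?M = ?N")
proof (rule measure_eqI_generator_eq[where E="range atMost" and \<Omega>=UNIV and A="\<lambda>i. {..real i}"])
  show "Int_stable (range (atMost :: real \<Rightarrow> real set))"
    by (auto simp: Int_stable_def)
  show "sets ?M = sigma_sets UNIV (range atMost)" "sets ?N = sigma_sets UNIV (range atMost)"
    by (simp_all add: borel_eq_atMost)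
  show "(\<Union>i. {..real i}) = UNIV" by (auto intro: real_arch_simple)
  show "emeasure ?M {..real i} \<noteq> \<infinity>" for i unfolding emeasure_norm_atMost by simp
  fix X :: "real set" assume "X \<in> range atMost"
  then obtain x where X: "X = {..x}" by auto
  let ?c = "unit_ball_vol (real DIM('a))"
  have "emeasure ?N X = (\<integral>\<^sup>+r. ennreal (real DIM('a) * ?c * r ^ (DIM('a) - 1)) * indicator {0..x} r \<partial>lborel)"
    unfolding X by (subst emeasure_density) (auto intro!: nn_integral_cong split: split_indicator)
  also have "\<dots> = (if x < 0 then 0 else ennreal (?c * x ^ DIM('a)))"
  proof (cases "x < 0")
    case False
    have "(\<integral>\<^sup>+r. ennreal (real DIM('a) * ?c * r ^ (DIM('a) - 1)) * indicator {0..x} r \<partial>lborel)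
      = ennreal (?c * x ^ DIM('a) - ?c * 0 ^ DIM('a))"
      by (rule nn_integral_FTC_Icc[where F="\<lambda>r. ?c * r ^ DIM('a)"])
        (use False in \<open>auto intro!: derivative_eq_intros\<close>)
    then show ?thesis using False by simp
  qed simp
  finally show "emeasure ?M X = emeasure ?N X" unfolding X emeasure_norm_atMost by simp
qed auto

text \<open>The absolute value extends \<open>h\<close> evenly, so that continuity on the whole line
  concerns only the values of \<open>h\<close> at nonnegative arguments.\<close>

lemma integrable_radial_iff:
  fixes h :: "real \<Rightarrow> real"
  assumes h: "continuous_on UNIV (\<lambda>r. h \<bar>r\<bar>)"
  shows "integrable lborel (\<lambda>y::'a::euclidean_space. h (norm y)) \<longleftrightarrow>
    set_integrable lborel {0..} (\<lambda>r. r ^ (DIM('a) - 1) * h r)"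
proof -
  define c where "c = real DIM('a) * unit_ball_vol (DIM('a))"
  have c: "c > 0" by (simp add: c_def)
  have m: "(\<lambda>r. h \<bar>r\<bar>) \<in> borel_measurable borel" using h by (rule borel_measurable_continuous_onI)
  have "integrable lborel (\<lambda>y::'a. h (norm y)) \<longleftrightarrow> integrable lborel (\<lambda>y::'a. h \<bar>norm y\<bar>)" by simp
  also have "\<dots> \<longleftrightarrow> integrable (distr lborel borel (norm :: 'a \<Rightarrow> real)) (\<lambda>r. h \<bar>r\<bar>)"
    using m by (subst integrable_distr_eq) auto
  also have "\<dots> \<longleftrightarrow> integrable (density lborel (\<lambda>r. ennreal (c * r ^ (DIM('a) - 1) * indicator {0..} r))) (\<lambda>r. h \<bar>r\<bar>)"
    unfolding distr_norm_lborel c_def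
    by (intro arg_cong2[where f=integrable] arg_cong2[where f=density] refl ext) (auto split: split_indicator)
  also have "\<dots> \<longleftrightarrow> integrable lborel (\<lambda>r. (c * r ^ (DIM('a) - 1) * indicator {0..} r) *\<^sub>R h \<bar>r\<bar>)"
    using m c by (subst integrable_density) (auto split: split_indicator)
  also have "\<dots> \<longleftrightarrow> integrable lborel (\<lambda>r. c *\<^sub>R (indicator {0..} r *\<^sub>R (r ^ (DIM('a) - 1) * h r)))"
    by (intro arg_cong2[where f=integrable] refl ext) (auto split: split_indicator)
  also have "\<dots> \<longleftrightarrow> set_integrable lborel {0..} (\<lambda>r. r ^ (DIM('a) - 1) * h r)"
    unfolding set_integrable_def real_scaleR_def integrable_mult_right_iff using c by simp
  finally show ?thesis .
qed

text \<open>\<open>F\<close> is nondecreasing and bounded, so it has a limit, and the fundamental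
  theorem on the half-line makes \<open>F'\<close> integrable. It dominates \<open>k\<close> there;
  the initial segment is compact.\<close>

lemma set_integrable_if_dominated_by_bounded_primitive:
  fixes k F :: "real \<Rightarrow> real"
  assumes k: "continuous_on {0..} k" and a: "a \<ge> 0"
    and F: "\<And>r. r \<ge> a \<Longrightarrow> (F has_real_derivative F' r) (at r)"
    and cF: "continuous_on {a..} F'"
    and le: "\<And>r. r \<ge> a \<Longrightarrow> \<bar>k r\<bar> \<le> F' r"
    and bdd: "\<And>r. r \<ge> a \<Longrightarrow> F r \<le> B"
  shows "set_integrable lborel {0..} k"
proof -
  have mono: "F r \<le> F t" if "a \<le> r" "r \<le> t" for r t
    by (rule DERIV_nonneg_imp_nondecreasing[OF that(2)]) (use F le that in \<open>meson abs_ge_zero order_trans\<close>)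
  define T where "T = Sup (F ` {a..})"
  have bd: "bdd_above (F ` {a..})" using bdd by (auto intro!: bdd_aboveI)
  have lim: "(F \<longlongrightarrow> T) at_top"
  proof (rule order_tendstoI)
    fix x assume "x < T"
    then obtain r where r: "r \<ge> a" "x < F r" unfolding T_def by (subst (asm) less_cSup_iff) (use bd in auto)
    then show "\<forall>\<^sub>F t in at_top. x < F t" using mono[of r]
      by (intro eventually_mono[OF eventually_ge_at_top[of r]]) (auto intro: less_le_trans)
  next
    fix x assume "x > T"
    moreover have "F t \<le> T" if "t \<ge> a" for t unfolding T_def using bd that by (intro cSup_upper) auto
    ultimately show "\<forall>\<^sub>F t in at_top. F t < x"
      by (intro eventually_mono[OF eventually_ge_at_top[of a]]) (auto intro: le_less_trans)
  qed
  define G where "G r = indicator {a..} r * F' r" for r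
  have Gm: "G \<in> borel_measurable borel"
    using borel_measurable_continuous_on_indicator[OF _ cF] unfolding G_def by simp
  have "(\<integral>\<^sup>+x. ennreal (G x) * indicator {a ..} x \<partial>lborel) = T - F a"
    by (rule nn_integral_FTC_atLeast[OF Gm _ _ lim])
      (use F le in \<open>auto simp: G_def intro: order_trans[OF abs_ge_zero]\<close>)
  also have "(\<integral>\<^sup>+x. ennreal (G x) * indicator {a ..} x \<partial>lborel) = (\<integral>\<^sup>+x. ennreal (G x) \<partial>lborel)"
    by (intro nn_integral_cong) (auto simp: G_def split: split_indicator)
  finally have "integrable lborel G"
    using Gm le by (intro integrableI_nonneg) (auto simp: G_def intro!: AE_I2 intro: order_trans[OF abs_ge_zero] split: split_indicator)
  then have "set_integrable lborel {a..} F'" by (simp add: set_integrable_def G_def[abs_def])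
  then have 1: "set_integrable lborel {a..} k"
  proof (rule set_integrable_bound)
    show "set_borel_measurable lborel {a..} k"
      unfolding set_borel_measurable_def
      using borel_measurable_continuous_on_indicator[OF _ continuous_on_subset[OF k, of "{a..}"]] a by auto
    show "AE x in lborel. x \<in> {a..} \<longrightarrow> norm (k x) \<le> norm (F' x)"
      using le by (intro AE_I2) force
  qed
  have 2: "set_integrable lborel {0..a} k"
    by (rule borel_integrable_atLeastAtMost'[OF continuous_on_subset[OF k]]) auto
  have "set_integrable lborel ({0..a} \<union> {a..}) k" by (rule set_integrable_Un[OF 2 1]) auto
  also have "{0..a} \<union> {a..} = {0..}" using a by auto
  finally show ?thesis .
qed

text \<open>\<open>F\<close> is compared with the primitive of \<open>k\<close> from
  \<open>a\<close>, which is at most the total integral. Applied to an \<open>F\<close> that grows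
  logarithmically, this refutes integrability.\<close>

lemma bounded_primitive_if_set_integrable:
  fixes k F :: "real \<Rightarrow> real"
  assumes int: "set_integrable lborel {0..} k" and k: "continuous_on {0..} k" and a: "a > 0"
    and pos: "\<And>r. r \<ge> a \<Longrightarrow> k r \<ge> 0"
    and F: "\<And>r. r \<ge> a \<Longrightarrow> (F has_real_derivative F' r) (at r)"
    and le: "\<And>r. r \<ge> a \<Longrightarrow> F' r \<le> k r"
  shows "\<exists>B. \<forall>r\<ge>a. F r \<le> B"
proof -
  have int': "set_integrable lborel {a..} k"
    by (rule set_integrable_subset[OF int]) (use a in auto)
  have "F r \<le> F a + (LINT x:{a..}|lborel. k x)" if r: "r \<ge> a" for r
  proof -
    define W where "W x = integral {a..x} k" for x
    have c: "continuous_on {a..r} k" using a by (intro continuous_on_subset[OF k]) auto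
    have dW: "(W has_real_derivative k x) (at x)" if "a < x" "x < r" for x
      using integral_has_real_derivative[OF c, of x] that unfolding W_def
      by (auto simp: at_within_Icc_at)
    have cW: "continuous_on {a..r} W"
      unfolding W_def by (intro indefinite_integral_continuous_1 integrable_continuous_real c)
    have cF: "continuous_on {a..r} F"
      using F by (meson DERIV_isCont atLeastAtMost_iff continuous_at_imp_continuous_on)
    have "W a - F a \<le> W r - F r"
    proof (rule DERIV_nonneg_imp_increasing_open[OF r])
      fix x assume "a < x" "x < r"
      then show "\<exists>y. ((\<lambda>x. W x - F x) has_real_derivative y) (at x) \<and> 0 \<le> y"
        using DERIV_diff[OF dW F[of x]] le[of x] by (intro exI[of _ "k x - F' x"]) auto
    qed (intro continuous_intros cW cF)
    moreover have "W a = 0" by (simp add: W_def)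
    moreover have "W r = (LINT x:{a..r}|lborel. k x)"
      unfolding W_def by (rule set_borel_integral_eq_integral(2)[symmetric]) (rule borel_integrable_atLeastAtMost'[OF c])
    moreover have "(LINT x:{a..r}|lborel. k x) \<le> (LINT x:{a..}|lborel. k x)"
      unfolding set_lebesgue_integral_def
      by (intro integral_mono set_integrable_subset[OF int', unfolded set_integrable_def] int'[unfolded set_integrable_def])
        (use pos in \<open>auto split: split_indicator\<close>)
    ultimately show ?thesis by linarith
  qed
  then show ?thesis by blast
qed

section \<open>Radial profiles\<close>

lemma powr_diff_bounds:
  fixes x y q :: real
  assumes "0 < x" "x \<le> y" "q \<ge> 1"
  shows "q * x powr (q - 1) * (y - x) \<le> y powr q - x powr q"
    and "y powr q - x powr q \<le> q * y powr (q - 1) * (y - x)"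
proof -
  have "q * x powr (q - 1) * (y - x) \<le> y powr q - x powr q \<and> y powr q - x powr q \<le> q * y powr (q - 1) * (y - x)"
  proof (cases "x = y")
    case False
    have "((\<lambda>z. z powr q) has_real_derivative q * z powr (q - 1)) (at z)" if "x \<le> z" for z
      using that assms by (intro has_real_derivative_powr) auto
    then obtain z where z: "x < z" "z < y" "y powr q - x powr q = (y - x) * (q * z powr (q - 1))"
      using MVT2[of x y "\<lambda>z. z powr q" "\<lambda>z. q * z powr (q - 1)"] False assms by auto
    have "x powr (q - 1) \<le> z powr (q - 1)" "z powr (q - 1) \<le> y powr (q - 1)"
      using z assms by (auto intro!: powr_mono2)
    then have "(y - x) * (q * x powr (q - 1)) \<le> (y - x) * (q * z powr (q - 1))"
      "(y - x) * (q * z powr (q - 1)) \<le> (y - x) * (q * y powr (q - 1))"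
      using assms by (auto intro!: mult_left_mono)
    then show ?thesis using z(3) by (simp add: ac_simps)
  qed simp
  then show "q * x powr (q - 1) * (y - x) \<le> y powr q - x powr q"
    "y powr q - x powr q \<le> q * y powr (q - 1) * (y - x)" by auto
qed

lemma exp_at_bot_right: "filterlim (exp :: real \<Rightarrow> real) (at_right 0) at_bot"
  using exp_at_bot by (simp add: filterlim_at)

lemma powr_less_powr_iff:
  fixes a b c :: real
  assumes "0 < a" "0 < b" "0 < c"
  shows "a powr c < b powr c \<longleftrightarrow> a < b"
proof
  assume *: "a powr c < b powr c"
  show "a < b"
  proof (rule ccontr)
    assume "\<not> a < b"
    then have "b powr c \<le> a powr c" using assms by (intro powr_mono2) auto
    then show False using * by simp
  qed
qed (use assms in \<open>auto intro: powr_less_mono2\<close>)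

lemma powr_lipschitz:
  fixes x y q B :: real
  assumes "0 < x" "0 < y" "x \<le> B" "y \<le> B" "q \<ge> 1"
  shows "\<bar>x powr q - y powr q\<bar> \<le> q * B powr (q - 1) * \<bar>x - y\<bar>"
proof -
  have *: "\<bar>b powr q - a powr q\<bar> \<le> q * B powr (q - 1) * \<bar>b - a\<bar>" if "0 < a" "a \<le> b" "b \<le> B" for a b
  proof -
    have "a powr q \<le> b powr q" using that assms by (intro powr_mono2) auto
    then have "\<bar>b powr q - a powr q\<bar> = b powr q - a powr q" by simp
    also have "\<dots> \<le> q * b powr (q - 1) * (b - a)" using powr_diff_bounds(2) that assms by simp
    also have "\<dots> \<le> q * B powr (q - 1) * (b - a)"
      using that assms by (intro mult_right_mono mult_left_mono powr_mono2) auto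
    finally show ?thesis using that by simp
  qed
  show ?thesis
  proof (cases "x \<le> y")
    case True then show ?thesis using *[of x y] assms by (simp add: abs_minus_commute)
  next
    case False then show ?thesis using *[of y x] assms by simp
  qed
qed

text \<open>The radial equation as a first order system for \<open>g = f\<^sup>m\<close> and the flux
  \<open>j = g' + \<beta> r f\<close>, in the parameters \<open>p = 2m/(1-m)\<close> and \<open>d = (n-2-nm)/(1-m)\<close>, so that
  \<open>n = p + d + 2\<close>, \<open>1/m = 1 + 2/p\<close> and \<open>\<alpha> - n\<beta> = (p+2)/2 - d\<beta>\<close>.\<close>

locale profile =
  fixes p d \<beta> g0 :: real and g j :: "real \<Rightarrow> real"
  assumes p_pos: "p > 0" and d_pos: "d > 0"
    and g_pos: "\<And>r. r > 0 \<Longrightarrow> g r > 0"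
    and dg: "\<And>r. r > 0 \<Longrightarrow> (g has_real_derivative j r - \<beta> * r * g r powr (1 + 2/p)) (at r)"
    and dj: "\<And>r. r > 0 \<Longrightarrow> (j has_real_derivative
      - (p + d + 1) / r * j r - ((p + 2)/2 - d * \<beta>) * g r powr (1 + 2/p)) (at r)"
    and g0_pos: "g0 > 0" and g_lim: "(g \<longlongrightarrow> g0) (at_right 0)" and j_lim: "(j \<longlongrightarrow> 0) (at_right 0)"
begin

text \<open>In terms of the solution this is \<open>r\<^sup>2 * f powr (1 - m)\<close>, because
  \<open>g = f powr m\<close> and \<open>2/p = (1 - m)/m\<close>.\<close>

definition w :: "real \<Rightarrow> real" where "w r = r\<^sup>2 * g r powr (2/p)"

text \<open>The factor normalises the equilibrium value \<open>2 * d * p / (p + 2)\<close> of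
  \<open>w\<close> to 1.\<close>

definition U :: "real \<Rightarrow> real" where "U s = ln (w (exp s) * ((p + 2) / (2 * d * p)))"

text \<open>The logarithmic derivative of \<open>w\<close> with respect to \<open>ln r\<close>,
  written with the flux \<open>j\<close> in place of the derivative of \<open>g\<close> so that it
  can be differentiated once more.\<close>

definition X :: "real \<Rightarrow> real" where
  "X s = 2 + (2/p) * (exp s * j (exp s) / g (exp s) - \<beta> * w (exp s))"

lemma w_pos: "r > 0 \<Longrightarrow> w r > 0"
  using g_pos[of r] by (simp add: w_def)

lemma exp_U: "exp (U s) = w (exp s) * ((p + 2) / (2 * d * p))"
  unfolding U_def by (rule exp_ln) (use w_pos p_pos d_pos in auto)

lemma dw: "((\<lambda>s. w (exp s)) has_real_derivative w (exp s) * X s) (at s)"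
proof -
  define r where "r = exp s"
  have r: "r > 0" by (simp add: r_def)
  have "((\<lambda>s. (exp s)\<^sup>2 * g (exp s) powr (2/p)) has_real_derivative
      2 * r\<^sup>2 * g r powr (2/p) + r\<^sup>2 * (2/p * g r powr (2/p - 1) * ((j r - \<beta> * r * g r powr (1 + 2/p)) * r))) (at s)"
    unfolding r_def
    by (rule derivative_eq_intros DERIV_fun_powr DERIV_chain2[OF dg] g_pos refl exp_gt_zero)+
      (simp add: power2_eq_square)
  moreover have "g r powr (2/p - 1) = g r powr (2/p) / g r" "g r powr (1 + 2/p) = g r * g r powr (2/p)"
    using g_pos[OF r] by (simp_all add: powr_diff powr_add)
  ultimately show ?thesis unfolding X_def w_def r_def[symmetric]
    by (simp add: field_simps power2_eq_square) (use g_pos[OF r] p_pos in \<open>simp add: field_simps\<close>)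
qed

lemma dU: "(U has_real_derivative X s) (at s)"
proof -
  have "w (exp s) * ((p + 2) / (2 * d * p)) > 0" using w_pos p_pos d_pos by simp
  then show ?thesis unfolding U_def
    by (auto intro!: derivative_eq_intros dw) (use p_pos d_pos in \<open>simp add: field_simps\<close>)
qed

text \<open>The algebra behind the second order equation: \<open>xi\<close> stands for
  \<open>r * j r / g r\<close>, \<open>v\<close> for \<open>w\<close> and \<open>e\<close> for
  \<open>exp U\<close>. The left side is the derivative of \<open>X\<close>, which the identity
  expresses in \<open>X\<close> and \<open>U\<close> alone.\<close>

lemma dX_aux:
  fixes xi v x e :: real
  assumes "xi = (p/2) * (x - 2) + \<beta> * v" "e = v * ((p + 2) / (2 * d * p))"
  shows "(2/p) * (- (p + d) * xi - ((p + 2)/2 - d * \<beta>) * v - xi\<^sup>2 + \<beta> * v * xi - \<beta> * (v * x))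
    = - (p/2) * x\<^sup>2 - (d - p + 2 * d * \<beta> * e) * x - 2 * d * (e - 1)"
  unfolding assms using p_pos d_pos by (simp add: field_simps power2_eq_square)

lemma dX: "(X has_real_derivative - (p/2) * (X s)\<^sup>2
    - (d - p + 2 * d * \<beta> * exp (U s)) * X s - 2 * d * (exp (U s) - 1)) (at s)"
proof -
  define r where "r = exp s"
  have r: "r > 0" by (simp add: r_def)
  define xi where "xi = r * j r / g r"
  have gq: "g r powr (1 + 2/p) = g r * g r powr (2/p)" using g_pos[OF r] by (simp add: powr_add)
  have "((\<lambda>s. exp s * j (exp s) / g (exp s)) has_real_derivative
     ((r * j r + r * ((- (p + d + 1) / r * j r - ((p + 2)/2 - d * \<beta>) * g r powr (1 + 2/p)) * r)) * g r
       - r * j r * ((j r - \<beta> * r * g r powr (1 + 2/p)) * r)) / (g r * g r)) (at s)"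
    unfolding r_def
    by (rule derivative_eq_intros DERIV_chain2[OF dg] DERIV_chain2[OF dj] refl exp_gt_zero)+
      (use g_pos[of "exp s"] in simp_all)
  also have "((r * j r + r * ((- (p + d + 1) / r * j r - ((p + 2)/2 - d * \<beta>) * g r powr (1 + 2/p)) * r)) * g r
       - r * j r * ((j r - \<beta> * r * g r powr (1 + 2/p)) * r)) / (g r * g r)
     = - (p + d) * xi - ((p + 2)/2 - d * \<beta>) * w r - xi\<^sup>2 + \<beta> * w r * xi"
    unfolding xi_def w_def gq using r g_pos[OF r] by (simp add: field_simps power2_eq_square)
  finally have dxi: "((\<lambda>s. exp s * j (exp s) / g (exp s)) has_real_derivative
     - (p + d) * xi - ((p + 2)/2 - d * \<beta>) * w r - xi\<^sup>2 + \<beta> * w r * xi) (at s)" .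
  have "(X has_real_derivative (2/p) * (- (p + d) * xi - ((p + 2)/2 - d * \<beta>) * w r - xi\<^sup>2 + \<beta> * w r * xi - \<beta> * (w r * X s))) (at s)"
    unfolding X_def[abs_def]
    by (rule derivative_eq_intros dxi dw refl)+ (simp add: X_def r_def)
  also have "(2/p) * (- (p + d) * xi - ((p + 2)/2 - d * \<beta>) * w r - xi\<^sup>2 + \<beta> * w r * xi - \<beta> * (w r * X s))
    = - (p/2) * (X s)\<^sup>2 - (d - p + 2 * d * \<beta> * exp (U s)) * X s - 2 * d * (exp (U s) - 1)"
  proof (rule dX_aux)
    have "(p/2) * ((2/p) * (xi - \<beta> * w r)) = xi - \<beta> * w r" using p_pos by simp
    then show "xi = (p/2) * (X s - 2) + \<beta> * w r" by (simp add: X_def xi_def r_def)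
  qed (simp add: r_def exp_U)
  finally show ?thesis .
qed

lemma w_lim: "((\<lambda>s. w (exp s)) \<longlongrightarrow> 0) at_bot"
proof -
  have "((\<lambda>r. r\<^sup>2 * g r powr (2/p)) \<longlongrightarrow> 0\<^sup>2 * g0 powr (2/p)) (at_right 0)"
    by (intro tendsto_intros g_lim) (use g0_pos in auto)
  then have "(w \<longlongrightarrow> 0) (at_right 0)" by (simp add: w_def[abs_def])
  then show ?thesis by (rule filterlim_compose) (rule exp_at_bot_right)
qed

lemma X_lim: "(X \<longlongrightarrow> 2) at_bot"
proof -
  have "((\<lambda>r. r * j r / g r) \<longlongrightarrow> 0 * 0 / g0) (at_right 0)"
    by (intro tendsto_intros g_lim j_lim) (use g0_pos in auto)
  then have "((\<lambda>s. exp s * j (exp s) / g (exp s)) \<longlongrightarrow> 0) at_bot"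
    using filterlim_compose[OF _ exp_at_bot_right] by simp
  from tendsto_add[OF tendsto_const tendsto_mult[OF tendsto_const tendsto_diff[OF this tendsto_mult[OF tendsto_const w_lim]]],
    of 2 "2/p" \<beta>]
  show ?thesis by (simp add: X_def[abs_def])
qed

lemma U_lim: "filterlim U at_bot at_bot"
proof -
  have "((\<lambda>s. w (exp s) * ((p + 2) / (2 * d * p))) \<longlongrightarrow> 0 * ((p + 2) / (2 * d * p))) at_bot"
    by (intro tendsto_intros w_lim)
  moreover have "w (exp s) * ((p + 2) / (2 * d * p)) > 0" for s using w_pos p_pos d_pos by simp
  ultimately have "filterlim (\<lambda>s. w (exp s) * ((p + 2) / (2 * d * p))) (at_right 0) at_bot"
    using w_pos[THEN less_imp_neq, THEN not_sym, OF exp_gt_zero] p_pos d_pos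
    by (intro filterlim_at[THEN iffD2] conjI always_eventually allI) simp_all
  then show ?thesis unfolding U_def[abs_def] by (rule filterlim_compose[OF ln_at_0])
qed

sublocale lienard p d "2 * d * \<beta>" U X
  by unfold_locales (rule p_pos d_pos dU dX X_lim U_lim)+

lemma U_less_iff:
  assumes "profile p d \<beta> g0' g' j'"
  shows "U s < profile.U p d g' s \<longleftrightarrow> g (exp s) < g' (exp s)"
proof -
  interpret p': profile p d \<beta> g0' g' j' by fact
  have "U s < p'.U s \<longleftrightarrow> exp (U s) < exp (p'.U s)" by simp
  also have "\<dots> \<longleftrightarrow> g (exp s) powr (2/p) < g' (exp s) powr (2/p)"
  proof -
    have "(p + 2) / (2 * d * p) > 0" "(exp s)\<^sup>2 > 0" using p_pos d_pos by auto
    from this[THEN mult_less_cancel_right_pos] this[THEN mult_less_cancel_left_pos] show ?thesis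
      unfolding exp_U p'.exp_U w_def p'.w_def by (simp only:)
  qed
  also have "\<dots> \<longleftrightarrow> g (exp s) < g' (exp s)"
    by (rule powr_less_powr_iff) (use p_pos g_pos p'.g_pos in auto)
  finally show ?thesis .
qed

section \<open>Scaling and uniqueness of profiles\<close>

text \<open>The elliptic equation is invariant under replacing \<open>f r\<close> by
  \<open>L powr (2/(1 - m)) * f (L * r)\<close>; for \<open>g = f powr m\<close> the exponent
  becomes \<open>p\<close>, and the flux gains one more power of \<open>L\<close>.\<close>

lemma scale:
  assumes L: "L > 0"
  shows "profile p d \<beta> (L powr p * g0) (\<lambda>r. L powr p * g (L * r)) (\<lambda>r. L powr (p + 1) * j (L * r))"
proof
  show "p > 0" "d > 0" "L powr p * g0 > 0" using p_pos d_pos g0_pos L by auto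
  have f: "filterlim ((*) L) (at_right 0) (at_right 0)"
    using filterlim_times_pos[OF filterlim_ident L, of 0 0] by simp
  show "((\<lambda>r. L powr p * g (L * r)) \<longlongrightarrow> L powr p * g0) (at_right 0)"
    by (intro tendsto_intros filterlim_compose[OF g_lim f])
  have "((\<lambda>r. L powr (p + 1) * j (L * r)) \<longlongrightarrow> L powr (p + 1) * 0) (at_right 0)"
    by (intro tendsto_intros filterlim_compose[OF j_lim f])
  then show "((\<lambda>r. L powr (p + 1) * j (L * r)) \<longlongrightarrow> 0) (at_right 0)" by simp
  fix r :: real assume r: "r > 0"
  then have Lr: "L * r > 0" using L by simp
  show "L powr p * g (L * r) > 0" using g_pos[OF Lr] L by simp
  have e: "(L powr p * g (L * r)) powr (1 + 2/p) = L powr (p + 1) * L * g (L * r) powr (1 + 2/p)"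
  proof -
    have "p * (1 + 2/p) = p + 1 + 1" using p_pos by (simp add: field_simps)
    then show ?thesis using g_pos[OF Lr] L p_pos by (simp add: powr_mult powr_powr powr_add power2_eq_square)
  qed
  show "((\<lambda>r. L powr p * g (L * r)) has_real_derivative
      L powr (p + 1) * j (L * r) - \<beta> * r * (L powr p * g (L * r)) powr (1 + 2/p)) (at r)"
    unfolding e
    by (rule derivative_eq_intros DERIV_chain2[where f=g and g="\<lambda>r. L * r" and x=r, OF dg[OF Lr]] refl)+ (use L in \<open>simp add: powr_add algebra_simps\<close>)
  show "((\<lambda>r. L powr (p + 1) * j (L * r)) has_real_derivative
      - (p + d + 1) / r * (L powr (p + 1) * j (L * r))
      - ((p + 2)/2 - d * \<beta>) * (L powr p * g (L * r)) powr (1 + 2/p)) (at r)"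
    unfolding e
    by (rule derivative_eq_intros DERIV_chain2[where f=j and g="\<lambda>r. L * r" and x=r, OF dj[OF Lr]] refl)+
      (use L r in \<open>simp add: powr_add field_simps\<close>)
qed

lemma U_scaled:
  assumes "profile p d \<beta> g0' g' j'" "L > 0" "\<And>r. r > 0 \<Longrightarrow> g' r = L powr p * g (L * r)"
  shows "profile.U p d g' s = U (s + ln L)"
proof -
  interpret p': profile p d \<beta> g0' g' j' by fact
  have "p'.w (exp s) = w (exp (s + ln L))"
    using assms(2,3) g_pos[of "L * exp s"] p_pos
    by (simp add: p'.w_def w_def exp_add powr_mult powr_powr power_mult_distrib mult.commute)
  then show ?thesis by (simp add: p'.U_def U_def)
qed

lemma bounded_near_0:
  assumes R: "R > 0"
  shows "\<exists>B. \<forall>r. 0 < r \<and> r \<le> R \<longrightarrow> g r \<le> B"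
proof -
  have "\<forall>\<^sub>F r in at_right 0. g r < g0 + 1" using order_tendstoD(2)[OF g_lim] by simp
  then obtain e where e: "e > 0" "\<And>r. 0 < r \<Longrightarrow> r < e \<Longrightarrow> g r < g0 + 1"
    by (auto simp: eventually_at_right_field)
  have "continuous_on {e..R} g"
    using dg e(1) by (intro continuous_at_imp_continuous_on ballI DERIV_isCont[OF dg]) auto
  then have "bdd_above (g ` {e..R})"
    by (intro bounded_imp_bdd_above compact_imp_bounded compact_continuous_image) auto
  then obtain B where B: "\<And>r. e \<le> r \<Longrightarrow> r \<le> R \<Longrightarrow> g r \<le> B"
    unfolding bdd_above_def by auto (meson atLeastAtMost_iff)
  have "g r \<le> max (g0 + 1) B" if "0 < r" "r \<le> R" for r
    using e(2)[of r] B[of r] that by (cases "r < e") auto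
  then show ?thesis by blast
qed

text \<open>Gronwall for \<open>(g - g')\<^sup>2 + (j - j')\<^sup>2\<close>: the coefficient of \<open>j\<close> that is singular at
  the origin has the good sign.\<close>

lemma unique:
  assumes "profile p d \<beta> g0 g' j'" "R > 0"
  shows "g R = g' R"
proof -
  interpret p': profile p d \<beta> g0 g' j' by fact
  define q where "q = 1 + 2/p"
  have q: "q \<ge> 1" using p_pos by (simp add: q_def)
  obtain B1 B2 where B: "\<And>r. 0 < r \<Longrightarrow> r \<le> R \<Longrightarrow> g r \<le> B1" "\<And>r. 0 < r \<Longrightarrow> r \<le> R \<Longrightarrow> g' r \<le> B2"
    using bounded_near_0 p'.bounded_near_0 assms(2) by metis
  define L where "L = q * max B1 B2 powr (q - 1)"
  define ga where "ga = (p + 2)/2 - d * \<beta>"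
  define G where "G r = g r - g' r" for r
  define D where "D r = j r - j' r" for r
  define H where "H r = g r powr q - g' r powr q" for r
  define Q where "Q r = (G r)\<^sup>2 + (D r)\<^sup>2" for r
  \<comment> \<open>The three terms bound, in this order, the contributions of \<open>G * D\<close>,
    of \<open>\<beta> * r * G * H\<close> and of \<open>ga * D * H\<close> to the derivative of
    \<open>Q\<close>.\<close>
  define C where "C = 1 + 2 * (\<bar>\<beta>\<bar> * R * L) + \<bar>ga\<bar> * L"
  have L0: "L \<ge> 0" using q by (simp add: L_def)
  have HL: "\<bar>H r\<bar> \<le> L * \<bar>G r\<bar>" if "0 < r" "r \<le> R" for r
    unfolding H_def G_def L_def
    by (rule powr_lipschitz) (use B that g_pos p'.g_pos q in \<open>auto simp: le_max_iff_disj\<close>)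
  define Q' where "Q' r = 2 * G r * (D r - \<beta> * r * H r)
      + 2 * D r * (- (p + d + 1) / r * D r - ga * H r)" for r
  have dQ: "(Q has_real_derivative Q' r) (at r)" if "r > 0" for r
    unfolding Q_def[abs_def] G_def[abs_def] D_def[abs_def]
    by (rule derivative_eq_intros dg dj p'.dg p'.dj that refl)+
      (simp add: Q'_def G_def D_def H_def q_def ga_def algebra_simps add_divide_distrib diff_divide_distrib)
  have Q'_le: "Q' r \<le> C * Q r" if r: "0 < r" "r \<le> R" for r
  proof -
    have 1: "2 * (G r * D r) \<le> Q r"
      unfolding Q_def using sum_squares_bound[of "G r" "D r"] by simp
    have GG: "(G r)\<^sup>2 \<le> Q r" by (simp add: Q_def)
    have "- (\<beta> * r * (G r * H r)) \<le> \<bar>\<beta> * r * (G r * H r)\<bar>" by (rule abs_ge_minus_self)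
    also have "\<dots> = \<bar>\<beta>\<bar> * r * (\<bar>G r\<bar> * \<bar>H r\<bar>)" using r by (simp add: abs_mult)
    also have "\<dots> \<le> \<bar>\<beta>\<bar> * R * (\<bar>G r\<bar> * (L * \<bar>G r\<bar>))"
      using r HL[OF r] by (intro mult_mono) auto
    also have "\<dots> = \<bar>\<beta>\<bar> * R * L * (G r)\<^sup>2"
      by (simp add: power2_eq_square)
    also have "\<dots> \<le> \<bar>\<beta>\<bar> * R * L * Q r" using GG r L0 by (intro mult_left_mono) auto
    finally have 2: "- (\<beta> * r * (G r * H r)) \<le> \<bar>\<beta>\<bar> * R * L * Q r" .
    have "- (ga * (D r * H r)) \<le> \<bar>ga * (D r * H r)\<bar>" by (rule abs_ge_minus_self)
    also have "\<dots> = \<bar>ga\<bar> * (\<bar>D r\<bar> * \<bar>H r\<bar>)" by (simp add: abs_mult)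
    also have "\<dots> \<le> \<bar>ga\<bar> * (\<bar>D r\<bar> * (L * \<bar>G r\<bar>))"
      using HL[OF r] by (intro mult_left_mono) auto
    also have "\<dots> = \<bar>ga\<bar> * L * (\<bar>D r\<bar> * \<bar>G r\<bar>)" by simp
    finally have 3: "- (ga * (D r * H r)) \<le> \<bar>ga\<bar> * L * (\<bar>D r\<bar> * \<bar>G r\<bar>)" .
    have "2 * (\<bar>ga\<bar> * L * (\<bar>D r\<bar> * \<bar>G r\<bar>)) = \<bar>ga\<bar> * L * (2 * \<bar>D r\<bar> * \<bar>G r\<bar>)" by simp
    also have "\<dots> \<le> \<bar>ga\<bar> * L * Q r"
      using sum_squares_bound[of "\<bar>D r\<bar>" "\<bar>G r\<bar>"] L0 by (intro mult_left_mono) (auto simp: Q_def)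
    finally have 5: "2 * (\<bar>ga\<bar> * L * (\<bar>D r\<bar> * \<bar>G r\<bar>)) \<le> \<bar>ga\<bar> * L * Q r" .
    define a where "a = (p + d + 1) / r"
    have 4: "a * (D r * D r) \<ge> 0" using p_pos d_pos r by (simp add: a_def)
    have "Q' r = 2 * G r * (D r - \<beta> * r * H r) + 2 * D r * (- a * D r - ga * H r)"
      by (simp only: Q'_def a_def minus_divide_left)
    then have "Q' r = 2 * (G r * D r) + 2 * (- (\<beta> * r * (G r * H r))) + (- (2 * (ga * (D r * H r))))
        - 2 * (a * (D r * D r))"
      by (simp add: algebra_simps)
    also have "\<dots> \<le> Q r + 2 * (\<bar>\<beta>\<bar> * R * L * Q r) + \<bar>ga\<bar> * L * Q r"
      using 1 2 3 4 5 by linarith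
    finally show ?thesis by (simp add: C_def algebra_simps)
  qed
  \<comment> \<open>\<open>Q r * exp (- C * r)\<close> is nonincreasing and tends to 0 at the
    origin, where both profiles have the same values of \<open>g\<close> and of the flux.\<close>
  have "Q R * exp (- C * R) \<le> 0"
  proof (rule tendsto_lowerbound)
    have "((\<lambda>r. ((g r - g' r)\<^sup>2 + (j r - j' r)\<^sup>2) * exp (- C * r)) \<longlongrightarrow>
        ((g0 - g0)\<^sup>2 + (0 - 0)\<^sup>2) * exp (- C * 0)) (at_right 0)"
      by (intro tendsto_intros g_lim p'.g_lim j_lim p'.j_lim)
    then show "((\<lambda>r. Q r * exp (- C * r)) \<longlongrightarrow> 0) (at_right 0)"
      by (simp add: Q_def G_def D_def)
    show "\<forall>\<^sub>F r in at_right 0. Q R * exp (- C * R) \<le> Q r * exp (- C * r)"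
      unfolding eventually_at_right_field
    proof (intro exI[of _ R] conjI allI impI assms(2))
      fix r assume r: "0 < r" "r < R"
      have "- (Q r * exp (- C * r)) \<le> - (Q R * exp (- C * R))"
      proof (rule deriv_nonneg_mono[where F="\<lambda>r. - (Q r * exp (- C * r))" and F'="\<lambda>r. (C * Q r - Q' r) * exp (- C * r)"])
        show "((\<lambda>r. - (Q r * exp (- C * r))) has_real_derivative (C * Q x - Q' x) * exp (- C * x)) (at x)"
          if "r \<le> x" for x
        proof -
          have "((\<lambda>r. exp (- C * r)) has_real_derivative - C * exp (- C * x)) (at x)"
            by (auto intro!: derivative_eq_intros)
          from DERIV_minus[OF DERIV_mult[OF dQ this]] show ?thesis
            by (rule DERIV_cong) (use that r in \<open>simp_all add: algebra_simps\<close>)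
        qed
        show "0 \<le> (C * Q x - Q' x) * exp (- C * x)" if "r < x" "x < R" for x
          using Q'_le[of x] that r by simp
      qed (use r in simp)
      then show "Q R * exp (- C * R) \<le> Q r * exp (- C * r)" by simp
    qed
  qed simp
  then have "Q R \<le> 0" by (simp add: mult_le_0_iff)
  then have "G R = 0" unfolding Q_def by (simp add: sum_power2_le_zero_iff)
  then show ?thesis by (simp add: G_def)
qed

end

section \<open>The difference of two profiles\<close>

lemma ln_unbounded:
  fixes e B R :: real
  assumes "e > 0"
  obtains r where "r \<ge> R" "e * ln r > B"
proof
  let ?r = "max R (exp ((B + 1) / e))"
  show "?r \<ge> R" by simp
  have "(B + 1) / e = ln (exp ((B + 1) / e))" by simp
  also have "\<dots> \<le> ln ?r" by (subst ln_le_cancel_iff) (auto simp: less_max_iff_disj)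
  finally have "e * ((B + 1) / e) \<le> e * ln ?r" using assms by (intro mult_left_mono) auto
  then show "e * ln ?r > B" using assms by simp
qed

locale profile_pair = lo: profile p d \<beta> a g1 j1 + hi: profile p d \<beta> b g2 j2
  for p d \<beta> a b :: real and g1 j1 g2 j2 :: "real \<Rightarrow> real"
begin

text \<open>This is \<open>\<alpha> - n * \<beta>\<close>; it vanishes exactly for the Barenblatt
  parameter.\<close>

definition ga :: real where "ga = (p + 2) / 2 - d * \<beta>"

text \<open>With \<open>p + d + 1 = n - 1\<close> and \<open>g powr (1 + 2/p) = f\<close>, this is
  the radial integrand of the difference of the two solutions.\<close>

definition k :: "real \<Rightarrow> real" where
  "k r = r powr (p + d + 1) * (g2 r powr (1 + 2/p) - g1 r powr (1 + 2/p))"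

text \<open>The exponent is \<open>n - 2\<close>: with this weight \<open>K r\<close> and
  \<open>r * k r\<close> are comparable as long as \<open>U\<close> stays bounded.\<close>

definition K :: "real \<Rightarrow> real" where "K r = r powr (p + d) * (g2 r - g1 r)"

definition J :: "real \<Rightarrow> real" where "J r = r powr (p + d + 1) * (j2 r - j1 r)"

text \<open>The mass identity in differential form: the weight \<open>r powr (p + d + 1)\<close> is
  the integrating factor for the singular term of \<open>dj\<close>.\<close>

lemma dJ: assumes "r > 0" shows "(J has_real_derivative - ga * k r) (at r)"
proof -
  have "(J has_real_derivative ((p + d + 1) * r powr (p + d + 1 - 1)) * (j2 r - j1 r)
      + ((- (p + d + 1) / r * j2 r - ((p + 2)/2 - d * \<beta>) * g2 r powr (1 + 2/p))
       - (- (p + d + 1) / r * j1 r - ((p + 2)/2 - d * \<beta>) * g1 r powr (1 + 2/p))) * r powr (p + d + 1)) (at r)"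
    unfolding J_def[abs_def]
    by (intro DERIV_mult DERIV_diff has_real_derivative_powr lo.dj hi.dj assms)
  moreover have "r powr (p + d + 1) = r powr (p + d + 1 - 1) * r" using assms by (simp add: powr_add)
  ultimately show ?thesis
    by (elim DERIV_cong) (use assms in \<open>simp add: k_def ga_def field_simps\<close>)
qed

lemma dK: assumes "r > 0"
  shows "(K has_real_derivative ((p + d) * K r + J r) / r - \<beta> * k r) (at r)"
proof -
  have "(K has_real_derivative ((p + d) * r powr (p + d - 1)) * (g2 r - g1 r)
      + ((j2 r - \<beta> * r * g2 r powr (1 + 2/p)) - (j1 r - \<beta> * r * g1 r powr (1 + 2/p))) * r powr (p + d)) (at r)"
    unfolding K_def[abs_def]
    by (intro DERIV_mult DERIV_diff has_real_derivative_powr lo.dg hi.dg assms)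
  moreover define Z where "Z = r powr (p + d)"
  have e: "r powr (p + d + 1) = Z * r" "r powr (p + d - 1) = Z / r"
    using assms by (simp_all add: Z_def powr_add powr_diff)
  ultimately show ?thesis
    unfolding k_def K_def J_def Z_def[symmetric]
    by (elim DERIV_cong, unfold e Z_def[symmetric]) (use assms in \<open>simp add: field_simps\<close>)
qed

text \<open>Mean value bounds for \<open>z powr (1 + 2/p)\<close>: its derivative at
  \<open>g r\<close>, multiplied by \<open>r\<^sup>2\<close>, is \<open>(p + 2) / p * w r\<close>,
  which is \<open>2 * d * exp (U (ln r))\<close>.\<close>

lemma k_bounds:
  assumes r: "r > 0" and le: "g1 r \<le> g2 r"
  shows "2 * d * exp (lo.U (ln r)) * K r \<le> r * k r" "r * k r \<le> 2 * d * exp (hi.U (ln r)) * K r"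
proof -
  have q: "1 + 2/p \<ge> 1" using lo.p_pos by simp
  have c: "r powr (p + d + 2) \<ge> 0" by simp
  have rk: "r * k r = r powr (p + d + 2) * (g2 r powr (1 + 2/p) - g1 r powr (1 + 2/p))"
    using r by (simp add: k_def powr_add power2_eq_square)
  have pd: "p \<noteq> 0" "d \<noteq> 0" using lo.p_pos lo.d_pos by auto
  have lo: "2 * d * exp (lo.U (ln r)) * K r = r powr (p + d + 2) * ((1 + 2/p) * g1 r powr (1 + 2/p - 1) * (g2 r - g1 r))"
    using r pd by (simp add: lo.exp_U lo.w_def K_def powr_add field_simps)
  have hi: "2 * d * exp (hi.U (ln r)) * K r = r powr (p + d + 2) * ((1 + 2/p) * g2 r powr (1 + 2/p - 1) * (g2 r - g1 r))"
    using r pd by (simp add: hi.exp_U hi.w_def K_def powr_add field_simps)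
  show "2 * d * exp (lo.U (ln r)) * K r \<le> r * k r" unfolding lo rk
    by (rule mult_left_mono[OF powr_diff_bounds(1)[OF lo.g_pos[OF r] le q] c])
  show "r * k r \<le> 2 * d * exp (hi.U (ln r)) * K r" unfolding hi rk
    by (rule mult_left_mono[OF powr_diff_bounds(2)[OF lo.g_pos[OF r] le q] c])
qed

lemma k_pos: "r > 0 \<Longrightarrow> g1 r < g2 r \<Longrightarrow> k r > 0"
  unfolding k_def using lo.g_pos[of r] lo.p_pos by (auto intro!: mult_pos_pos powr_less_mono2 add_pos_pos)

lemma K_pos: "r > 0 \<Longrightarrow> g1 r < g2 r \<Longrightarrow> K r > 0"
  unfolding K_def by simp

lemma J_lim: "(J \<longlongrightarrow> 0) (at_right 0)"
proof -
  have "((\<lambda>r. r powr (p + d + 1)) \<longlongrightarrow> 0 powr (p + d + 1)) (at_right 0)"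
    using lo.p_pos lo.d_pos by (intro tendsto_powr' tendsto_intros) (auto simp: eventually_at_right_field intro: exI[of _ 1])
  from tendsto_mult[OF this tendsto_diff[OF hi.j_lim lo.j_lim]]
  show ?thesis by (simp add: J_def[abs_def])
qed

lemma J_mono:
  assumes "0 < r" "r \<le> t" "\<And>x. r < x \<Longrightarrow> x < t \<Longrightarrow> ga * k x \<ge> 0"
  shows "J t \<le> J r"
proof -
  have "- J r \<le> - J t"
    by (rule deriv_nonneg_mono[where F="\<lambda>x. - J x", OF assms(2) DERIV_minus[OF dJ]]) (use assms in auto)
  then show ?thesis by simp
qed

lemma J_mono':
  assumes "0 < r" "r \<le> t" "\<And>x. r < x \<Longrightarrow> x < t \<Longrightarrow> ga * k x \<le> 0"
  shows "J r \<le> J t"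
  by (rule deriv_nonneg_mono[OF assms(2) dJ]) (use assms in auto)

lemma J_nonpos:
  assumes "0 < r" "\<And>x. 0 < x \<Longrightarrow> ga * k x \<ge> 0"
  shows "J r \<le> 0"
proof (rule tendsto_lowerbound[OF J_lim])
  show "\<forall>\<^sub>F x in at_right 0. J r \<le> J x"
    unfolding eventually_at_right_field using J_mono assms by (intro exI[of _ r]) auto
qed simp

lemma J_nonneg:
  assumes "0 < r" "\<And>x. 0 < x \<Longrightarrow> ga * k x \<le> 0"
  shows "J r \<ge> 0"
proof (rule tendsto_upperbound[OF J_lim])
  show "\<forall>\<^sub>F x in at_right 0. J r \<ge> J x"
    unfolding eventually_at_right_field using J_mono' assms by (intro exI[of _ r]) auto
qed simp

section \<open>Integrability and non-integrability of the difference\<close>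

context
  assumes k_cont: "continuous_on {0..} k"
begin

lemma bounded_of_integrable:
  assumes int: "set_integrable lborel {0..} k" and R: "R > 0"
    and pos: "\<And>r. r \<ge> R \<Longrightarrow> k r \<ge> 0" and C: "C \<ge> 0"
    and F: "\<And>r. r \<ge> R \<Longrightarrow> (F has_real_derivative F' r) (at r)"
    and le: "\<And>r. r \<ge> R \<Longrightarrow> F' r \<le> C * k r"
  shows "\<exists>B. \<forall>r\<ge>R. F r \<le> B"
  by (rule bounded_primitive_if_set_integrable[where k="\<lambda>r. C * k r", OF _ _ R _ F le])
    (use int k_cont pos C in \<open>auto intro!: continuous_intros set_integrable_mult_right\<close>)

text \<open>The lower bound for \<open>K\<close> yields \<open>k r \<ge> c1 * e / r\<close>, whose
  primitive is unbounded.\<close>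

lemma not_integrable_of_K_ge:
  assumes R: "R > 0" and less: "\<And>r. r \<ge> R \<Longrightarrow> g1 r < g2 r" and c1: "c1 > 0" and e: "e > 0"
    and k_ge: "\<And>r. r \<ge> R \<Longrightarrow> c1 * K r \<le> r * k r" and K_ge: "\<And>r. r \<ge> R \<Longrightarrow> K r \<ge> e"
  shows "\<not> set_integrable lborel {0..} k"
proof
  assume int: "set_integrable lborel {0..} k"
  have le: "c1 * e / r \<le> k r" if r: "r \<ge> R" for r
  proof -
    have "c1 * e \<le> c1 * K r" using K_ge[OF r] c1 by simp
    also have "\<dots> \<le> r * k r" by (rule k_ge[OF r])
    finally show ?thesis using R r by (simp add: field_simps)
  qed
  have "\<exists>B. \<forall>r\<ge>R. c1 * e * ln r \<le> B"
    by (rule bounded_of_integrable[OF int R, where C=1 and F'="\<lambda>r. c1 * e / r"])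
      (use R le k_pos less in \<open>auto intro!: derivative_eq_intros less_imp_le simp: less_le_trans\<close>)
  then obtain B where "\<forall>r\<ge>R. c1 * e * ln r \<le> B" by blast
  moreover obtain r where "r \<ge> R" "c1 * e * ln r > B" using ln_unbounded[of "c1 * e"] c1 e by auto
  ultimately show False by force
qed

lemma not_integrable:
  assumes less: "\<And>r. r > 0 \<Longrightarrow> g1 r < g2 r" and low: "\<And>s. s \<ge> 0 \<Longrightarrow> lo.U s \<ge> cl"
    and up: "ga = 0 \<Longrightarrow> d > 2 \<and> (\<forall>s. hi.U s \<le> 0)"
  shows "\<not> set_integrable lborel {0..} k"
proof
  assume int: "set_integrable lborel {0..} k"
  define c1 where "c1 = 2 * d * exp cl"
  have c1: "c1 > 0" using lo.d_pos by (simp add: c1_def)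
  have kp: "k r > 0" and Kp: "K r > 0" if "r > 0" for r using k_pos K_pos less that by auto
  have k_ge: "c1 * K r \<le> r * k r" if "r \<ge> 1" for r
  proof -
    have "c1 * K r \<le> 2 * d * exp (lo.U (ln r)) * K r"
      unfolding c1_def using low[of "ln r"] lo.d_pos Kp[of r] that by (intro mult_right_mono mult_left_mono) auto
    also have "\<dots> \<le> r * k r" using k_bounds(1)[of r] less[of r] that by simp
    finally show ?thesis .
  qed
  consider "ga > 0" | "ga < 0" | "ga = 0" by linarith
  then show False
  proof cases
    \<comment> \<open>\<open>J\<close> stays below \<open>J 1 < 0\<close>. Up to multiples of
      \<open>k\<close>, the derivative of \<open>K\<close> is then at most \<open>J 1 / r\<close>,
      so integrability would drive \<open>K\<close> to minus infinity although
      \<open>K > 0\<close>.\<close>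
    case 1
    have J1: "J 1 < 0"
    proof -
      have "- J (1/2) < - J 1"
        by (rule deriv_pos_less[where F="\<lambda>x. - J x", OF _ DERIV_minus[OF dJ]]) (use 1 kp in auto)
      then show ?thesis using J_nonpos[of "1/2"] 1 kp by (auto simp: less_imp_le)
    qed
    have Jle: "J r \<le> J 1" if "r \<ge> 1" for r using J_mono[of 1 r] that 1 kp by (simp add: less_imp_le)
    define C where "C = (p + d) / c1 + \<bar>\<beta>\<bar>"
    have "\<exists>B. \<forall>r\<ge>1. K r + (- J 1) * ln r \<le> B"
    proof (rule bounded_of_integrable[OF int, where C=C])
      show "C \<ge> 0" using c1 lo.p_pos lo.d_pos by (simp add: C_def)
      fix r :: real assume r: "r \<ge> 1"
      show "k r \<ge> 0" using kp[of r] r by simp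
      show "((\<lambda>r. K r + (- J 1) * ln r) has_real_derivative
          (((p + d) * K r + J r) / r - \<beta> * k r) + (- J 1) / r) (at r)"
        using r by (auto intro!: derivative_eq_intros dK)
      have "(p + d) * (c1 * K r) \<le> (p + d) * (r * k r)"
        using k_ge[OF r] lo.p_pos lo.d_pos by (intro mult_left_mono) auto
      then have "(p + d) * K r / r \<le> (p + d) / c1 * k r"
        using c1 r by (simp add: field_simps)
      moreover have "J r / r \<le> J 1 / r" using Jle[OF r] r by (simp add: divide_right_mono)
      moreover have "- \<beta> * k r \<le> \<bar>\<beta>\<bar> * k r" using kp[of r] r by (intro mult_right_mono) auto
      ultimately show "(((p + d) * K r + J r) / r - \<beta> * k r) + (- J 1) / r \<le> C * k r"
        by (simp add: C_def add_divide_distrib algebra_simps)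
    qed simp
    then obtain B where B: "\<And>r. r \<ge> 1 \<Longrightarrow> K r + (- J 1) * ln r \<le> B" by blast
    obtain r where "r \<ge> 1" "(- J 1) * ln r > B" using ln_unbounded[of "- J 1"] J1 by auto
    then show False using B[of r] Kp[of r] by simp
  next
    \<comment> \<open>\<open>J\<close> stays above \<open>J 1 > 0\<close>, so integrability would
      make \<open>K\<close> grow at least logarithmically; but then \<open>k\<close> dominates a
      multiple of \<open>1 / r\<close>.\<close>
    case 2
    have J1: "J 1 > 0"
    proof -
      have "J (1/2) < J 1"
        by (rule deriv_pos_less[OF _ dJ]) (use 2 kp in \<open>auto simp: mult_less_0_iff\<close>)
      then show ?thesis using J_nonneg[of "1/2"] 2 kp by (auto simp: less_imp_le mult_le_0_iff)
    qed
    have Jge: "J r \<ge> J 1" if "r \<ge> 1" for r using J_mono'[of 1 r] that 2 kp by (simp add: less_imp_le mult_le_0_iff)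
    have "\<exists>B. \<forall>r\<ge>1. J 1 * ln r - K r \<le> B"
    proof (rule bounded_of_integrable[OF int, where C="\<bar>\<beta>\<bar>"])
      fix r :: real assume r: "r \<ge> 1"
      show "k r \<ge> 0" using kp[of r] r by simp
      show "((\<lambda>r. J 1 * ln r - K r) has_real_derivative
          J 1 / r - (((p + d) * K r + J r) / r - \<beta> * k r)) (at r)"
        using r by (auto intro!: derivative_eq_intros dK)
      have "(p + d) * K r / r \<ge> 0" using Kp[of r] lo.p_pos lo.d_pos r by simp
      moreover have "J r / r \<ge> J 1 / r" using Jge[OF r] r by (simp add: divide_right_mono)
      moreover have "\<beta> * k r \<le> \<bar>\<beta>\<bar> * k r" using kp[of r] r by (intro mult_right_mono) auto
      ultimately show "J 1 / r - (((p + d) * K r + J r) / r - \<beta> * k r) \<le> \<bar>\<beta>\<bar> * k r"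
        by (simp add: add_divide_distrib algebra_simps)
    qed auto
    then obtain B where B: "\<And>r. r \<ge> 1 \<Longrightarrow> J 1 * ln r - K r \<le> B" by blast
    obtain R where R: "R \<ge> 1" "J 1 * ln R > B + 1" using ln_unbounded[of "J 1"] J1 by auto
    have "K r \<ge> 1" if "r \<ge> R" for r
    proof -
      have "J 1 * ln R \<le> J 1 * ln r" using J1 that R by (intro mult_left_mono) auto
      then show ?thesis using B[of r] that R by simp
    qed
    then show False
      using not_integrable_of_K_ge[of R c1 1] R c1 less k_ge int by force
  next
    \<comment> \<open>The flux difference vanishes identically. As \<open>U \<le> 0\<close> for the
      upper profile and \<open>2 * d * \<beta> = p + 2 < p + d\<close>, the function
      \<open>K\<close> does not decrease and so stays above \<open>K 1 > 0\<close>.\<close>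
    case 3
    have J0: "J r = 0" if "r > 0" for r
      using J_nonneg[OF that] J_nonpos[OF that] 3 by auto
    have db: "2 * d * \<beta> = p + 2" using 3 by (simp add: ga_def field_simps)
    then have "0 < 2 * d * \<beta>" using lo.p_pos by simp
  then have bp: "\<beta> > 0" by (rule zero_less_mult_pos) (use lo.d_pos in simp)
    have "K r \<ge> K 1" if "r \<ge> 1" for r
    proof (rule deriv_nonneg_mono[OF that dK])
      fix x :: real assume x: "1 < x"
      have "x * k x \<le> 2 * d * exp (hi.U (ln x)) * K x" using k_bounds(2)[of x] less[of x] x by simp
      also have "\<dots> \<le> 2 * d * 1 * K x"
        using up[OF 3] lo.d_pos Kp[of x] x by (intro mult_right_mono mult_left_mono) auto
      finally have "\<beta> * (x * k x) \<le> \<beta> * (2 * d * K x)" using bp by (intro mult_left_mono) auto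
      also have "\<dots> = 2 * d * \<beta> * K x" by simp
      also have "\<dots> = (p + 2) * K x" by (simp only: db)
      also have "\<dots> \<le> (p + d) * K x" using up[OF 3] Kp[of x] x by (intro mult_right_mono) auto
      finally show "0 \<le> ((p + d) * K x + J x) / x - \<beta> * k x" using J0[of x] x by (simp add: field_simps)
    qed auto
    then show False
      using not_integrable_of_K_ge[of 1 c1 "K 1"] c1 less k_ge int Kp[of 1] by force
  qed
qed

text \<open>Beyond the overshoot, \<open>U \<ge> 0\<close> and
  \<open>2 * d * \<beta> \<ge> p + d\<close> give
  \<open>(p + d) * K r \<le> \<beta> * (r * k r)\<close>, so the derivative of \<open>K\<close> is
  at most \<open>J r / r\<close>. If the decreasing \<open>J\<close> fell to \<open>- 1\<close>,
  then \<open>K r + ln r\<close> would not increase and \<open>K\<close> would become negative. So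
  \<open>- J / ga\<close> is a bounded primitive of \<open>k\<close>.\<close>

lemma integrable_of_overshoot:
  assumes ga: "ga > 0" and R: "R > 0" and less: "\<And>r. r \<ge> R \<Longrightarrow> g1 r < g2 r"
    and low: "\<And>r. r \<ge> R \<Longrightarrow> lo.U (ln r) \<ge> 0" and b: "2 * d * \<beta> \<ge> p + d"
  shows "set_integrable lborel {0..} k"
proof -
  have kp: "k r > 0" and Kp: "K r > 0" if "r \<ge> R" for r using k_pos K_pos less R that by auto
  have bp: "\<beta> > 0"
  proof -
    have "0 < 2 * d * \<beta>" using b lo.p_pos lo.d_pos by linarith
    then show ?thesis by (rule zero_less_mult_pos) (use lo.d_pos in simp)
  qed
  have K'_le: "((p + d) * K r + J r) / r - \<beta> * k r \<le> J r / r" if r: "r \<ge> R" for r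
  proof -
    have "2 * d * 1 * K r \<le> 2 * d * exp (lo.U (ln r)) * K r"
      using low[OF r] lo.d_pos Kp[OF r] by (intro mult_right_mono mult_left_mono) auto
    also have "\<dots> \<le> r * k r" using k_bounds(1)[of r] less[OF r] R r by simp
    finally have "\<beta> * (2 * d * K r) \<le> \<beta> * (r * k r)" using bp by (intro mult_left_mono) auto
    moreover have "(p + d) * K r \<le> (2 * d * \<beta>) * K r" using b Kp[OF r] by (intro mult_right_mono) auto
    ultimately have "(p + d) * K r + J r \<le> \<beta> * (r * k r) + J r" by (simp add: algebra_simps)
    then have "((p + d) * K r + J r) / r \<le> (\<beta> * (r * k r) + J r) / r"
      using R r by (intro divide_right_mono) auto
    also have "\<dots> = \<beta> * k r + J r / r" using R r by (simp add: add_divide_distrib)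
    finally show ?thesis by simp
  qed
  have J_dec: "J t \<le> J r" if "R \<le> r" "r \<le> t" for r t
    using J_mono[of r t] that R ga kp by (simp add: less_imp_le)
  have J_gt: "J r > - 1" if r: "r \<ge> R" for r
  proof (rule ccontr)
    assume "\<not> J r > - 1"
    then have J1: "J t \<le> - 1" if "t \<ge> r" for t using J_dec[OF r that] by linarith
    have le: "K t + ln t \<le> K r + ln r" if "t \<ge> r" for t
    proof -
      have "- (K r + ln r) \<le> - (K t + ln t)"
      proof (rule deriv_nonneg_mono[where F="\<lambda>t. - (K t + ln t)", OF that])
        show "((\<lambda>t. - (K t + ln t)) has_real_derivative
            - ((((p + d) * K x + J x) / x - \<beta> * k x) + 1 / x)) (at x)" if "r \<le> x" for x
          using that r R by (auto intro!: derivative_eq_intros dK)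
        fix x assume x: "r < x"
        have "((p + d) * K x + J x) / x - \<beta> * k x \<le> J x / x" using K'_le[of x] x r by simp
        also have "\<dots> \<le> - 1 / x" using J1[of x] x r R by (intro divide_right_mono) auto
        finally show "0 \<le> - ((((p + d) * K x + J x) / x - \<beta> * k x) + 1 / x)" by simp
      qed
      then show ?thesis by simp
    qed
    obtain t where "t \<ge> r" "1 * ln t > K r + ln r" using ln_unbounded[of 1] by auto
    then show False using le[of t] Kp[of t] r by simp
  qed
  show ?thesis
  proof (rule set_integrable_if_dominated_by_bounded_primitive[OF k_cont, where a=R and F="\<lambda>r. - J r / ga" and F'=k and B="1 / ga"])
    show "((\<lambda>r. - J r / ga) has_real_derivative k r) (at r)" if "r \<ge> R" for r
      using that R ga by (auto intro!: derivative_eq_intros dJ)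
    show "continuous_on {R..} k" using R by (intro continuous_on_subset[OF k_cont]) auto
    show "\<bar>k r\<bar> \<le> k r" if "r \<ge> R" for r using kp[OF that] by simp
    show "- J r / ga \<le> 1 / ga" if "r \<ge> R" for r using J_gt[OF that] ga by (intro divide_right_mono) auto
  qed (use R in simp)
qed

text \<open>Here the flux difference vanishes, and \<open>exp U\<close> tends to 1, so that
  eventually \<open>\<beta> * (r * k r)\<close> exceeds \<open>(p + d) * K r\<close> by at least
  \<open>c * K r\<close>. Hence \<open>K\<close> decreases fast enough for a negative multiple of
  it, bounded above by 0, to have a derivative dominating \<open>k\<close>.\<close>

lemma integrable_of_explicit:
  assumes ga: "ga = 0" and d: "d < 2" and less: "\<And>r. r > 0 \<Longrightarrow> g1 r < g2 r"
    and up: "\<And>s. hi.U s \<le> 0" and lim: "(lo.U \<longlongrightarrow> 0) at_top"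
  shows "set_integrable lborel {0..} k"
proof -
  have kp: "k r > 0" and Kp: "K r > 0" if "r > 0" for r using k_pos K_pos less that by auto
  have J0: "J r = 0" if "r > 0" for r
    using J_nonneg[OF that] J_nonpos[OF that] ga by auto
  have db: "2 * d * \<beta> = p + 2" using ga by (simp add: ga_def field_simps)
  then have "0 < 2 * d * \<beta>" using lo.p_pos by simp
  then have bp: "\<beta> > 0" by (rule zero_less_mult_pos) (use lo.d_pos in simp)
  \<comment> \<open>Half of the gap between \<open>p + d\<close> and \<open>p + 2\<close>: one half
    absorbs the deviation of \<open>exp U\<close> from 1, the other is left as the decay rate of
    \<open>K\<close>.\<close>
  define c where "c = (2 - d) / 2"
  have c: "c > 0" using d by (simp add: c_def)
  have "((\<lambda>s. exp (lo.U s)) \<longlongrightarrow> exp 0) at_top" by (intro tendsto_intros lim)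
  moreover have "1 - c / (p + 2) < 1" using c lo.p_pos by simp
  ultimately have "\<forall>\<^sub>F s in at_top. exp (lo.U s) > 1 - c / (p + 2)"
    by (simp add: order_tendstoD(1))
  then obtain s0 where s0: "\<And>s. s \<ge> s0 \<Longrightarrow> exp (lo.U s) > 1 - c / (p + 2)"
    by (auto simp: eventually_at_top_linorder)
  define R where "R = exp s0"
  have R: "R > 0" by (simp add: R_def)
  have main: "k r \<le> - (2 * d / c) * ((p + d) * K r / r - \<beta> * k r)" if r: "r \<ge> R" for r
  proof -
    have r0: "r > 0" using R r by linarith
    have "ln r \<ge> s0" using r R by (simp add: R_def ln_ge_iff[OF r0])
    from s0[OF this] have "(p + 2) * (1 - c / (p + 2)) \<le> (p + 2) * exp (lo.U (ln r))"
      using lo.p_pos by (intro mult_left_mono) auto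
    moreover have "(p + 2) * (1 - c / (p + 2)) = p + 2 - c"
      using lo.p_pos by (simp add: right_diff_distrib)
    moreover have "p + 2 - c = p + d + c" by (simp add: c_def field_simps)
    ultimately have "p + d + c \<le> (p + 2) * exp (lo.U (ln r))" by linarith
    then have "(p + d + c) * K r \<le> (p + 2) * exp (lo.U (ln r)) * K r"
      using Kp[OF r0] by (intro mult_right_mono) auto
    also have "\<dots> = \<beta> * (2 * d * exp (lo.U (ln r)) * K r)"
      unfolding db[symmetric] by (simp add: algebra_simps)
    also have "\<dots> \<le> \<beta> * (r * k r)"
      using k_bounds(1)[OF r0] less[OF r0] bp by (intro mult_left_mono) auto
    finally have 1: "c * K r \<le> - ((p + d) * K r - \<beta> * (r * k r))" by (simp add: algebra_simps)
    have "r * k r \<le> 2 * d * exp (hi.U (ln r)) * K r" using k_bounds(2)[OF r0] less[OF r0] by simp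
    also have "\<dots> \<le> 2 * d * 1 * K r"
      using up[of "ln r"] lo.d_pos Kp[OF r0] by (intro mult_right_mono mult_left_mono) auto
    also have "\<dots> = (2 * d / c) * (c * K r)" using c by simp
    also have "\<dots> \<le> (2 * d / c) * (- ((p + d) * K r - \<beta> * (r * k r)))"
      using 1 lo.d_pos c by (intro mult_left_mono) auto
    also have "y * (- ((p + d) * K r - \<beta> * (r * k r))) = r * (- y * ((p + d) * K r / r - \<beta> * k r))" for y
      using r0 by (simp add: field_simps)
    finally show ?thesis by (rule mult_left_le_imp_le) (rule r0)
  qed
  have dK': "(K has_real_derivative (p + d) * K r / r - \<beta> * k r) (at r)" if "r > 0" for r
    using dK[OF that] J0[OF that] by simp
  show ?thesis
  proof (rule set_integrable_if_dominated_by_bounded_primitive[OF k_cont, where a=R and B=0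
        and F="\<lambda>r. - (2 * d / c) * K r" and F'="\<lambda>r. - (2 * d / c) * ((p + d) * K r / r - \<beta> * k r)"])
    show "((\<lambda>r. - (2 * d / c) * K r) has_real_derivative - (2 * d / c) * ((p + d) * K r / r - \<beta> * k r)) (at r)"
      if "r \<ge> R" for r
      by (rule DERIV_cmult[OF dK']) (use that R in simp)
    have "continuous_on {R..} K"
      using R by (intro continuous_at_imp_continuous_on ballI DERIV_isCont[OF dK]) auto
    moreover have "continuous_on {R..} k" using R by (intro continuous_on_subset[OF k_cont]) auto
    ultimately show "continuous_on {R..} (\<lambda>r. - (2 * d / c) * ((p + d) * K r / r - \<beta> * k r))"
      using R by (intro continuous_intros) auto
    show "\<bar>k r\<bar> \<le> - (2 * d / c) * ((p + d) * K r / r - \<beta> * k r)" if "r \<ge> R" for r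
      using main[OF that] kp[of r] R that by simp
    show "- (2 * d / c) * K r \<le> 0" if "r \<ge> R" for r
    proof -
      have "0 \<le> 2 * d / c * K r" using lo.d_pos c Kp[of r] R that by simp
      then show ?thesis by simp
    qed
  qed (use R in simp)
qed

end

end

section \<open>Radial solutions of the elliptic equation\<close>

lemma norm_line_deriv:
  fixes y b :: "'a::euclidean_space"
  assumes "y \<noteq> 0"
  shows "((\<lambda>t. norm (y + t *\<^sub>R b)) has_real_derivative (y \<bullet> b) / norm y) (at 0)"
proof -
  have "((\<lambda>t. sqrt (y \<bullet> y + 2 * t * (y \<bullet> b) + t\<^sup>2 * (b \<bullet> b))) has_real_derivative
      (2 * (y \<bullet> b)) * (inverse (sqrt (y \<bullet> y)) / 2)) (at 0)"
  proof -
    have "((\<lambda>t. y \<bullet> y + 2 * t * (y \<bullet> b) + t\<^sup>2 * (b \<bullet> b)) has_real_derivative 2 * (y \<bullet> b)) (at 0)"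
      by (auto intro!: derivative_eq_intros)
    from DERIV_chain2[OF DERIV_real_sqrt this] assms show ?thesis by (simp add: ac_simps)
  qed
  moreover have "norm (y + t *\<^sub>R b) = sqrt (y \<bullet> y + 2 * t * (y \<bullet> b) + t\<^sup>2 * (b \<bullet> b))" for t
    by (simp add: norm_eq_sqrt_inner algebra_simps inner_commute power2_eq_square)
  moreover have "2 * (y \<bullet> b) * (inverse (sqrt (y \<bullet> y)) / 2) = (y \<bullet> b) / norm y"
    unfolding norm_eq_sqrt_inner[of y] divide_inverse by simp
  ultimately show ?thesis by (simp only:)
qed

lemma partial_deriv_radial:
  fixes y b :: "'a::euclidean_space"
  assumes "y \<noteq> 0" "(h has_real_derivative h') (at (norm y))"
  shows "((\<lambda>t. h (norm (y + t *\<^sub>R b))) has_real_derivative h' * ((y \<bullet> b) / norm y)) (at 0)"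
    and "partial_deriv b (\<lambda>z. h (norm z)) y = h' * ((y \<bullet> b) / norm y)"
proof -
  show *: "((\<lambda>t. h (norm (y + t *\<^sub>R b))) has_real_derivative h' * ((y \<bullet> b) / norm y)) (at 0)"
    by (rule DERIV_chain2[OF _ norm_line_deriv]) (use assms in simp_all)
  then show "partial_deriv b (\<lambda>z. h (norm z)) y = h' * ((y \<bullet> b) / norm y)"
    unfolding partial_deriv_def by (rule DERIV_imp_deriv)
qed

lemma laplacian_radial:
  fixes y :: "'a::euclidean_space"
  assumes y: "y \<noteq> 0" and h1: "\<And>r. r > 0 \<Longrightarrow> (h has_real_derivative h1 r) (at r)"
    and h2: "(h1 has_real_derivative h2) (at (norm y))"
  shows "laplacian (\<lambda>z. h (norm z)) y = h2 + (real DIM('a) - 1) / norm y * h1 (norm y)"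
proof -
  define R where "R = norm y"
  have R: "R > 0" using y by (simp add: R_def)
  have *: "partial_deriv b (partial_deriv b (\<lambda>z. h (norm z))) y
      = (h2 - h1 R / R) / R\<^sup>2 * (y \<bullet> b)\<^sup>2 + h1 R / R" if b: "b \<in> Basis" for b
  proof -
    \<comment> \<open>The radial formula for the first partial derivative holds off the origin,
      hence along the line for all small \<open>t\<close>, which suffices to differentiate it at
      0.\<close>
    have ev: "\<forall>\<^sub>F t in nhds 0. partial_deriv b (\<lambda>z. h (norm z)) (y + t *\<^sub>R b)
        = (\<lambda>r. h1 r / r) (norm (y + t *\<^sub>R b)) * (y \<bullet> b + t)"
    proof -
      have "((\<lambda>t::real. y + t *\<^sub>R b) \<longlongrightarrow> y + 0 *\<^sub>R b) (nhds 0)"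
        by (intro tendsto_intros filterlim_ident)
      then have "\<forall>\<^sub>F t::real in nhds 0. y + t *\<^sub>R b \<noteq> 0"
        by (rule tendsto_imp_eventually_ne) (use y in simp)
      then show ?thesis
      proof eventually_elim
        case (elim t)
        have "(y + t *\<^sub>R b) \<bullet> b = y \<bullet> b + t" using b by (simp add: inner_add_left)
        then show ?case using partial_deriv_radial(2)[OF elim h1, of b] elim by simp
      qed
    qed
    have "((\<lambda>r. h1 r / r) has_real_derivative (h2 - h1 R / R) / R) (at (norm y))"
      by (rule derivative_eq_intros h2 refl)+ (use R in \<open>simp_all add: R_def[symmetric] field_simps\<close>)
    moreover have "((\<lambda>t. y \<bullet> b + t) has_real_derivative 1) (at 0)"
      by (auto intro!: derivative_eq_intros)
    ultimately have "((\<lambda>t. (\<lambda>r. h1 r / r) (norm (y + t *\<^sub>R b)) * (y \<bullet> b + t)) has_real_derivative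
        (h2 - h1 R / R) / R * ((y \<bullet> b) / norm y) * (y \<bullet> b) + h1 R / R) (at 0)"
      by (intro DERIV_cong[OF DERIV_mult[OF partial_deriv_radial(1)[OF y]]]) (auto simp: R_def)
    then have D: "((\<lambda>t. partial_deriv b (\<lambda>z. h (norm z)) (y + t *\<^sub>R b)) has_real_derivative
        (h2 - h1 R / R) / R * ((y \<bullet> b) / norm y) * (y \<bullet> b) + h1 R / R) (at 0)"
      using DERIV_cong_ev[OF refl ev refl] by blast
    have "partial_deriv b (partial_deriv b (\<lambda>z. h (norm z))) y
        = deriv (\<lambda>t. partial_deriv b (\<lambda>z. h (norm z)) (y + t *\<^sub>R b)) 0"
      by (rule partial_deriv_def)
    also have "\<dots> = (h2 - h1 R / R) / R * ((y \<bullet> b) / norm y) * (y \<bullet> b) + h1 R / R"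
      by (rule DERIV_imp_deriv[OF D])
    finally show ?thesis by (simp add: R_def[symmetric] power2_eq_square)
  qed
  have sm: "(\<Sum>b\<in>Basis. C * (y \<bullet> b)\<^sup>2 + c) = C * (\<Sum>b\<in>Basis. (y \<bullet> b)\<^sup>2) + real DIM('a) * c" for C c
    by (simp add: sum.distrib sum_distrib_left)
  have "(\<Sum>b\<in>Basis. (y \<bullet> b)\<^sup>2) = R\<^sup>2"
    using euclidean_inner[of y y] by (simp only: R_def power2_norm_eq_inner power2_eq_square[of "y \<bullet> _"])
  moreover have "laplacian (\<lambda>z. h (norm z)) y = (\<Sum>b\<in>Basis. (h2 - h1 R / R) / R\<^sup>2 * (y \<bullet> b)\<^sup>2 + h1 R / R)"
    unfolding laplacian_def by (rule sum.cong[OF refl *])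
  ultimately have "laplacian (\<lambda>z. h (norm z)) y = (h2 - h1 R / R) / R\<^sup>2 * R\<^sup>2 + real DIM('a) * (h1 R / R)"
    by (simp only: sm)
  moreover have "(h2 - h1 R / R) / R\<^sup>2 * R\<^sup>2 = h2 - h1 R / R" using R by simp
  ultimately show ?thesis by (simp add: R_def[symmetric] diff_divide_distrib left_diff_distrib)
qed

lemma deriv_along_axis:
  fixes v :: "'a::euclidean_space \<Rightarrow> real"
  assumes "v differentiable (at (t *\<^sub>R e))"
  shows "((\<lambda>t. v (t *\<^sub>R e)) has_real_derivative partial_deriv e v (t *\<^sub>R e)) (at t)"
proof -
  obtain v' where v': "(v has_derivative v') (at (t *\<^sub>R e))" using assms by (auto simp: differentiable_def)
  have "((\<lambda>t. v (t *\<^sub>R e)) has_derivative (\<lambda>h. v' (h *\<^sub>R e))) (at t)"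
    by (rule has_derivative_compose[where f="\<lambda>t. t *\<^sub>R e" and g=v, OF _ v']) (auto intro!: derivative_eq_intros)
  moreover have "(\<lambda>h. v' (h *\<^sub>R e)) = (*) (v' e)"
    using has_derivative_linear[OF v'] by (auto simp: linear_cmul)
  ultimately have 1: "((\<lambda>t. v (t *\<^sub>R e)) has_real_derivative v' e) (at t)"
    by (simp add: has_field_derivative_def)
  then have "((\<lambda>s. v ((t + s) *\<^sub>R e)) has_real_derivative v' e) (at 0)"
    using DERIV_shift[of "\<lambda>t. v (t *\<^sub>R e)" "v' e" 0 t] by (simp add: add.commute)
  then have "partial_deriv e v (t *\<^sub>R e) = v' e"
    unfolding partial_deriv_def by (intro DERIV_imp_deriv) (simp add: scaleR_add_left)
  with 1 show ?thesis by simp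
qed

text \<open>On a coordinate axis the function is \<open>F \<bar>t\<bar>\<close>, twice
  differentiable and even. Evenness makes the first derivative vanish at 0, and its continuity gives
  the initial condition of the radial problem.\<close>

lemma C2_radial:
  fixes F :: "real \<Rightarrow> real"
  assumes C2: "C2_fun (\<lambda>y::'a::euclidean_space. F (norm y))"
  obtains F1 F2 where "\<And>r. r > 0 \<Longrightarrow> (F has_real_derivative F1 r) (at r)"
    "\<And>r. r > 0 \<Longrightarrow> (F1 has_real_derivative F2 r) (at r)"
    "(F1 \<longlongrightarrow> 0) (at_right 0)" "continuous_on UNIV (\<lambda>t. F \<bar>t\<bar>)"
proof -
  let ?u = "\<lambda>y::'a. F (norm y)"
  obtain e :: 'a where e: "e \<in> Basis" using nonempty_Basis by blast
  define F1 where "F1 t = partial_deriv e ?u (t *\<^sub>R e)" for t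
  define F2 where "F2 t = partial_deriv e (partial_deriv e ?u) (t *\<^sub>R e)" for t
  have nrm: "norm (t *\<^sub>R e) = \<bar>t\<bar>" for t using e by simp
  have dF: "((\<lambda>t. F \<bar>t\<bar>) has_real_derivative F1 t) (at t)" for t
    using deriv_along_axis[of ?u t e] C2 unfolding nrm F1_def by (simp add: C2_fun_def C1_fun_def)
  have dF1: "(F1 has_real_derivative F2 t) (at t)" for t
    using deriv_along_axis[of "partial_deriv e ?u" t e] C2 e unfolding F1_def[abs_def] F2_def
    by (simp add: C2_fun_def C1_fun_def)
  have "((\<lambda>t. F \<bar>- t\<bar>) has_real_derivative F1 0 * - 1) (at 0)"
    by (rule DERIV_chain2[where f="\<lambda>t. F \<bar>t\<bar>"]) (use dF in \<open>auto intro!: derivative_eq_intros\<close>)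
  then have "((\<lambda>t. F \<bar>t\<bar>) has_real_derivative - F1 0) (at 0)" by simp
  from DERIV_unique[OF dF[of 0] this] have "F1 0 = 0" by simp
  show thesis
  proof
    fix r :: real assume r: "r > 0"
    show "(F has_real_derivative F1 r) (at r)"
      by (rule has_field_derivative_transform_within_open[OF dF, where S="{0<..}"]) (use r in auto)
    show "(F1 has_real_derivative F2 r) (at r)" by (rule dF1)
  next
    show "(F1 \<longlongrightarrow> 0) (at_right 0)"
      using DERIV_isCont[OF dF1, of 0] \<open>F1 0 = 0\<close> by (auto simp: isCont_def intro: filterlim_mono[OF _ order_refl at_le])
    show "continuous_on UNIV (\<lambda>t. F \<bar>t\<bar>)"
      by (intro continuous_at_imp_continuous_on ballI DERIV_isCont[OF dF])
  qed
qed

text \<open>The flux absorbs the drift: \<open>\<beta> * r * F1 r\<close> is the derivative of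
  \<open>\<beta> * r * F r\<close> minus \<open>\<beta> * F r\<close>. Together with the term
  \<open>(n - 1) / r\<close> of the radial Laplacian this turns the coefficient \<alpha> of
  \<open>F\<close> into \<open>\<alpha> - n * \<beta>\<close>.\<close>

lemma elliptic_profile:
  fixes F :: "real \<Rightarrow> real" and m \<alpha> \<beta> p d :: real
  defines "p \<equiv> 2 * m / (1 - m)" and "d \<equiv> (real DIM('a) - 2 - real DIM('a) * m) / (1 - m)"
  assumes sol: "elliptic_solution m \<alpha> \<beta> (\<lambda>y::'a::euclidean_space. F (norm y))"
    and m: "0 < m" "m < 1" and d: "d > 0" and al: "\<alpha> = (2 * \<beta> + 1) / (1 - m)"
  shows "\<exists>j. profile p d \<beta> (F 0 powr m) (\<lambda>r. F r powr m) j"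
    and "continuous_on UNIV (\<lambda>t. F \<bar>t\<bar>)" and "r \<ge> 0 \<Longrightarrow> F r > 0"
proof -
  let ?u = "\<lambda>y::'a. F (norm y)"
  obtain F1 F2 where dF: "\<And>r. r > 0 \<Longrightarrow> (F has_real_derivative F1 r) (at r)"
    and dF1: "\<And>r. r > 0 \<Longrightarrow> (F1 has_real_derivative F2 r) (at r)"
    and F1_lim: "(F1 \<longlongrightarrow> 0) (at_right 0)" and cF: "continuous_on UNIV (\<lambda>t. F \<bar>t\<bar>)"
    using sol C2_radial[of F] unfolding elliptic_solution_def by metis
  show "continuous_on UNIV (\<lambda>t. F \<bar>t\<bar>)" by fact
  obtain e :: 'a where e: "e \<in> Basis" using nonempty_Basis by blast
  have F_pos: "F r > 0" if "r \<ge> 0" for r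
  proof -
    have "F (norm (r *\<^sub>R e)) > 0" using sol unfolding elliptic_solution_def by blast
    then show ?thesis using that e by simp
  qed
  then show "r \<ge> 0 \<Longrightarrow> F r > 0" .
  define h1 where "h1 r = m * F r powr (m - 1) * F1 r" for r
  define h2 where "h2 r = m * ((m - 1) * F r powr (m - 2) * F1 r * F1 r + F r powr (m - 1) * F2 r)" for r
  have dh: "((\<lambda>r. F r powr m) has_real_derivative h1 r) (at r)" if "r > 0" for r
    unfolding h1_def by (rule DERIV_cong[OF DERIV_fun_powr[OF dF F_pos]]) (use that in auto)
  have dh1: "(h1 has_real_derivative h2 r) (at r)" if "r > 0" for r
  proof -
    have "((\<lambda>r. F r powr (m - 1)) has_real_derivative (m - 1) * F r powr (m - 1 - 1) * F1 r) (at r)"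
      by (rule DERIV_cong[OF DERIV_fun_powr[OF dF F_pos]]) (use that in auto)
    from DERIV_mult[OF DERIV_cmult[OF this, of m] dF1[OF that]]
    show ?thesis unfolding h1_def[abs_def] by (rule DERIV_cong) (simp add: h2_def algebra_simps)
  qed
  have eq: "h2 r + (real DIM('a) - 1) / r * h1 r + \<alpha> * F r + \<beta> * (r * F1 r) = 0" if r: "r > 0" for r
  proof -
    define y where "y = r *\<^sub>R e"
    have y: "y \<noteq> 0" "norm y = r" using r e by (auto simp: y_def)
    have "laplacian (\<lambda>z::'a. F (norm z) powr m) y = h2 r + (real DIM('a) - 1) / r * h1 r"
      using laplacian_radial[of y "\<lambda>r. F r powr m" h1 "h2 r"] y dh dh1 r by simp
    moreover have "y \<bullet> grad ?u y = r * F1 r"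
    proof -
      have "y \<bullet> grad ?u y = (\<Sum>b\<in>Basis. F1 r * ((y \<bullet> b) / r) * (y \<bullet> b))"
        unfolding grad_def inner_sum_right
        using partial_deriv_radial(2)[OF y(1), of F "F1 r"] dF[OF r] y(2) by (simp add: ac_simps)
      also have "\<dots> = F1 r / r * (\<Sum>b\<in>Basis. (y \<bullet> b) * (y \<bullet> b))"
        by (simp add: sum_distrib_left ac_simps)
      also have "\<dots> = F1 r / r * (r * r)"
        unfolding euclidean_inner[of y y, symmetric]
        using power2_norm_eq_inner[of y] unfolding y(2) by (simp add: power2_eq_square)
      finally show ?thesis using r by simp
    qed
    moreover have "laplacian (\<lambda>z::'a. F (norm z) powr m) y + \<alpha> * F (norm y) + \<beta> * (y \<bullet> grad ?u y) = 0"
      using sol unfolding elliptic_solution_def by blast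
    ultimately show ?thesis using y(2) by simp
  qed
  have p: "p > 0" using m by (simp add: p_def)
  have "m * (1 + 2/p) = 1" using m by (simp add: p_def field_simps)
  then have Fq: "(F r powr m) powr (1 + 2/p) = F r" if "r \<ge> 0" for r
    using F_pos[OF that] by (simp add: powr_powr)
  have "(p + d) * (1 - m) = (real DIM('a) - 2) * (1 - m)"
    using m by (simp add: p_def d_def distrib_right) (simp add: algebra_simps)
  then have N: "real DIM('a) = p + d + 2" using m by simp
  have p2: "1 / (1 - m) = (p + 2) / 2" using m by (simp add: p_def field_simps)
  have "\<alpha> = (2 * \<beta> + 1) * (1 / (1 - m))" by (simp add: al)
  then have al': "\<alpha> - (p + d + 2) * \<beta> = (p + 2)/2 - d * \<beta>"
    unfolding p2 by (simp add: field_simps)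
  have F_lim: "(F \<longlongrightarrow> F 0) (at_right 0)"
  proof -
    have "((\<lambda>t. F \<bar>t\<bar>) \<longlongrightarrow> F \<bar>0\<bar>) (at 0)"
      using cF unfolding continuous_on_def by blast
    then have "((\<lambda>t. F \<bar>t\<bar>) \<longlongrightarrow> F 0) (at_right 0)"
      unfolding abs_zero by (rule tendsto_mono[OF at_le[OF subset_UNIV]])
    then show ?thesis
    proof (rule Lim_transform_eventually)
      show "\<forall>\<^sub>F t in at_right 0. F \<bar>t\<bar> = F t"
        using eventually_at_right_less[of "0::real"] by eventually_elim simp
    qed
  qed
  define j where "j r = h1 r + \<beta> * r * F r" for r
  have "profile p d \<beta> (F 0 powr m) (\<lambda>r. F r powr m) j"
  proof
    show "p > 0" "d > 0" by fact+
    show "F 0 powr m > 0" using F_pos[of 0] by simp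
    show "((\<lambda>r. F r powr m) \<longlongrightarrow> F 0 powr m) (at_right 0)"
      by (intro tendsto_intros F_lim) (use F_pos[of 0] in auto)
    have "(j \<longlongrightarrow> m * F 0 powr (m - 1) * 0 + \<beta> * 0 * F 0) (at_right 0)"
      unfolding j_def[abs_def] h1_def[abs_def]
      by (intro tendsto_intros F_lim F1_lim) (use F_pos[of 0] in auto)
    then show "(j \<longlongrightarrow> 0) (at_right 0)" by simp
    fix r :: real assume r: "r > 0"
    show "F r powr m > 0" using F_pos[of r] r by simp
    show "((\<lambda>r. F r powr m) has_real_derivative j r - \<beta> * r * (F r powr m) powr (1 + 2/p)) (at r)"
      using dh[OF r] Fq[of r] r by (simp add: j_def)
    have "(j has_real_derivative h2 r + (\<beta> * F r + \<beta> * r * F1 r)) (at r)"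
      unfolding j_def[abs_def]
      by (rule derivative_eq_intros dh1 dF r refl)+ simp
    moreover have "h2 r + (\<beta> * F r + \<beta> * r * F1 r)
      = - (p + d + 1) / r * j r - (\<alpha> - (p + d + 2) * \<beta>) * F r"
    proof -
      define c where "c = (p + d + 1) / r"
      have c: "- (p + d + 1) / r = - c" "(real DIM('a) - 1) / r = c"
        by (simp_all only: c_def minus_divide_left) (simp add: N)
      have "h2 r = - (c * h1 r) - \<alpha> * F r - \<beta> * (r * F1 r)"
        using eq[OF r] unfolding c by linarith
      moreover have "c * j r = c * h1 r + (p + d + 1) * \<beta> * F r"
        using r by (simp add: j_def c_def field_simps)
      ultimately show ?thesis unfolding c by (simp add: algebra_simps)
    qed
    ultimately show "(j has_real_derivative - (p + d + 1) / r * j r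
        - ((p + 2)/2 - d * \<beta>) * (F r powr m) powr (1 + 2/p)) (at r)"
      unfolding al' using Fq[of r] r by simp
  qed
  then show "\<exists>j. profile p d \<beta> (F 0 powr m) (\<lambda>r. F r powr m) j" by blast
qed

section \<open>Translation of the parameters and the theorem\<close>

text \<open>In \<open>p\<close> and \<open>d\<close> the thresholds become simple:
  \<open>\<beta> = beta1 n m\<close> reads \<open>2 * d * \<beta> = p + 2\<close>,
  \<open>m = (n - 4)/(n - 2)\<close> reads \<open>d = 2\<close>, and
  \<open>\<beta> > beta2 n m\<close> makes the two decay rates at the equilibrium real and
  distinct.\<close>

lemma parameter_identities:
  fixes N m \<beta> p d :: real
  defines "p \<equiv> 2 * m / (1 - m)" and "d \<equiv> (N - 2 - N * m) / (1 - m)"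
  assumes N: "N \<ge> 3" and m: "0 < m" "m < (N - 2) / N"
  shows "m < 1" "p > 0" "d > 0" "N = p + d + 2"
    and "\<beta> < 1 / (N - 2 - N * m) \<longleftrightarrow> 2 * d * \<beta> < p + 2"
    and "1 / (N - 2 - N * m) < \<beta> \<longleftrightarrow> p + 2 < 2 * d * \<beta>"
    and "m < (N - 4) / (N - 2) \<longleftrightarrow> d > 2" "(N - 4) / (N - 2) < m \<longleftrightarrow> d < 2"
    and "sqrt (2 * (1 - m) / (N - 2 - N * m)) + ((N + 2) * m - (N - 2)) / (2 * (N - 2 - N * m)) < \<beta> \<Longrightarrow>
      d - p + 2 * d * \<beta> > 2 * sqrt (2 * d)"
proof -
  have mN: "N * m < N - 2" using m(2) N by (simp add: pos_less_divide_eq mult.commute)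
  show m1: "m < 1"
  proof (rule ccontr)
    assume "\<not> m < 1"
    then have "N * 1 \<le> N * m" using N by (intro mult_left_mono) auto
    then show False using mN by simp
  qed
  show p: "p > 0" using m m1 by (simp add: p_def)
  show d: "d > 0" using mN m1 by (simp add: d_def)
  have pm: "p * (1 - m) = 2 * m" using m1 by (simp add: p_def)
  have dm: "d * (1 - m) = N - 2 - N * m" using m1 by (simp add: d_def)
  have "(p + d) * (1 - m) = (N - 2) * (1 - m)"
    using m1 by (simp add: p_def d_def distrib_right) (simp add: algebra_simps)
  then show Npd: "N = p + d + 2" using m1 by simp
  have p2: "p + 2 = 2 / (1 - m)" using m1 by (simp add: p_def field_simps)
  have "1 / (N - 2 - N * m) = (p + 2) / (2 * d)"
    unfolding dm[symmetric] p2 using d m1 by simp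
  then show "\<beta> < 1 / (N - 2 - N * m) \<longleftrightarrow> 2 * d * \<beta> < p + 2"
    "1 / (N - 2 - N * m) < \<beta> \<longleftrightarrow> p + 2 < 2 * d * \<beta>"
    using d by (simp_all add: pos_less_divide_eq pos_divide_less_eq mult.commute)
  have "d - 2 = (N - 4 - (N - 2) * m) / (1 - m)"
    using m1 by (simp add: d_def field_simps)
  then have d2: "d - 2 > 0 \<longleftrightarrow> N - 4 - (N - 2) * m > 0" "d - 2 < 0 \<longleftrightarrow> N - 4 - (N - 2) * m < 0"
    using m1 by (simp_all add: zero_less_divide_iff divide_less_0_iff)
  show "m < (N - 4) / (N - 2) \<longleftrightarrow> d > 2"
    using d2 N by (simp add: pos_less_divide_eq mult.commute)
  show "(N - 4) / (N - 2) < m \<longleftrightarrow> d < 2"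
    using d2 N by (simp add: pos_divide_less_eq mult.commute)
  assume be: "sqrt (2 * (1 - m) / (N - 2 - N * m)) + ((N + 2) * m - (N - 2)) / (2 * (N - 2 - N * m)) < \<beta>"
  have "2 * x / (d * x) = 2 / d" if "x \<noteq> 0" for x using that by simp
  from this[of "1 - m"] m1 have "2 * (1 - m) / (N - 2 - N * m) = 2 / d" by (simp only: dm)
  moreover have "((N + 2) * m - (N - 2)) / (2 * (N - 2 - N * m)) = (p - d) / (2 * d)"
  proof -
    have "(p - d) * (1 - m) = (N + 2) * m - (N - 2)"
      by (simp only: left_diff_distrib pm dm) (simp add: algebra_simps)
    moreover have "(p - d) * (1 - m) / (2 * (d * (1 - m))) = (p - d) / (2 * d)" using m1 by simp
    ultimately show ?thesis unfolding dm[symmetric] by simp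
  qed
  ultimately have "2 * d * (sqrt (2 / d) + (p - d) / (2 * d)) < 2 * d * \<beta>"
    using be d by simp
  moreover have "2 * d * (sqrt (2 / d) + (p - d) / (2 * d)) = 2 * (d * sqrt (2 / d)) + (p - d)"
    using d by (simp add: distrib_left)
  moreover have "d * sqrt (2 / d) = sqrt (2 * d)"
  proof -
    have "d * sqrt (2 / d) = sqrt (d\<^sup>2) * sqrt (2 / d)" using d by simp
    also have "\<dots> = sqrt (d\<^sup>2 * (2 / d))" by (rule real_sqrt_mult[symmetric])
    also have "d\<^sup>2 * (2 / d) = 2 * d" using d by (simp add: power2_eq_square)
    finally show ?thesis .
  qed
  ultimately show "d - p + 2 * d * \<beta> > 2 * sqrt (2 * d)" by simp
qed

theorem theorem1p3:
  fixes n :: nat and m \<alpha> \<beta> :: real and f :: "real \<Rightarrow> real \<Rightarrow> real"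
  assumes n_def: "n = CARD('n::finite)" and n_ge: "n \<ge> 3"
    and m_pos: "0 < m" and m_less: "m < (real n - 2) / real n"
    and beta: "\<beta> > beta0 n m"
    and alpha: "\<alpha> = (2 * \<beta> + 1) / (1 - m)"
    and sol: "\<And>l. l > 0 \<Longrightarrow> elliptic_solution m \<alpha> \<beta> (\<lambda>y::real^'n. f l (norm y))"
    and init: "\<And>l. l > 0 \<Longrightarrow> f l 0 = l powr (2 / (1 - m))"
  shows
    "(\<beta> > beta1 n m \<or>
      (n > 4 \<and> m < (real n - 4) / (real n - 2) \<and> \<beta> \<le> beta1 n m) \<longrightarrow>
        (\<forall>r l\<^sub>1 l\<^sub>2. 0 \<le> r \<and> 0 < l\<^sub>1 \<and> l\<^sub>1 < l\<^sub>2 \<longrightarrow> f l\<^sub>1 r < f l\<^sub>2 r) \<and>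
        (\<forall>l\<^sub>1 l\<^sub>2. 0 < l\<^sub>1 \<and> l\<^sub>1 < l\<^sub>2 \<longrightarrow>
           \<not> integrable lborel (\<lambda>y::real^'n. f l\<^sub>1 (norm y) - f l\<^sub>2 (norm y)))) \<and>
     ((n \<le> 4 \<and> \<beta> < beta1 n m) \<or>
      (n > 4 \<and> (real n - 4) / (real n - 2) < m \<and> \<beta> < beta1 n m) \<longrightarrow>
        (\<exists>R\<^sub>0>0. \<forall>r l\<^sub>1 l\<^sub>2. 0 < l\<^sub>1 \<and> l\<^sub>1 < l\<^sub>2 \<and> R\<^sub>0 / l\<^sub>1 \<le> r \<longrightarrow>
           f l\<^sub>1 r > f l\<^sub>2 r) \<and>
        (\<forall>l\<^sub>1 l\<^sub>2. 0 < l\<^sub>1 \<and> l\<^sub>1 < l\<^sub>2 \<longrightarrow>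
           integrable lborel (\<lambda>y::real^'n. f l\<^sub>1 (norm y) - f l\<^sub>2 (norm y)))) \<and>
     ((n \<le> 4 \<and> \<beta> = beta1 n m) \<or>
      (n > 4 \<and> (real n - 4) / (real n - 2) < m \<and> \<beta> = beta1 n m) \<longrightarrow>
        (\<forall>r l\<^sub>1 l\<^sub>2. 0 \<le> r \<and> 0 < l\<^sub>1 \<and> l\<^sub>1 < l\<^sub>2 \<longrightarrow> f l\<^sub>1 r < f l\<^sub>2 r) \<and>
        (\<forall>l\<^sub>1 l\<^sub>2. 0 < l\<^sub>1 \<and> l\<^sub>1 < l\<^sub>2 \<longrightarrow>
           integrable lborel (\<lambda>y::real^'n. f l\<^sub>1 (norm y) - f l\<^sub>2 (norm y))))"
proof -
  define p where "p = 2 * m / (1 - m)"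
  define d where "d = (real n - 2 - real n * m) / (1 - m)"
  have N3: "real n \<ge> 3" using n_ge by simp
  note par = parameter_identities[OF N3 m_pos m_less, folded p_def d_def]
  have m1: "m < 1" and p: "p > 0" and d: "d > 0" and npd: "real n = p + d + 2"
    using par(1-4) by auto
  have b1_less: "\<beta> < beta1 n m \<longleftrightarrow> 2 * d * \<beta> < p + 2"
    and b1_gr: "beta1 n m < \<beta> \<longleftrightarrow> p + 2 < 2 * d * \<beta>"
    unfolding beta1_def by (rule par(5), rule par(6))
  have disc: "d - p + 2 * d * \<beta> > 2 * sqrt (2 * d)"
    by (rule par(9)) (use beta in \<open>simp add: beta0_def beta2_def\<close>)
  have dim: "DIM(real^'n) = n" by (simp add: n_def)
  \<comment> \<open>For \<open>n \<le> 4\<close> the threshold \<open>(n - 4) / (n - 2)\<close> is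
    at most 0 and so lies below \<open>m\<close>; both alternatives of (b) and of (c) therefore give
    \<open>d < 2\<close>.\<close>
  have dlt: "d < 2" if "n \<le> 4 \<or> (real n - 4) / (real n - 2) < m"
  proof -
    have "(real n - 4) / (real n - 2) \<le> 0" if "n \<le> 4"
      using that n_ge by (intro divide_nonpos_nonneg) auto
    then show ?thesis using that par(8) m_pos by auto
  qed
  define g where "g l r = f l r powr m" for l r
  note ep = elliptic_profile[OF sol m_pos m1, unfolded dim, folded p_def d_def, OF _ d alpha]
  have f_pos: "f l r > 0" if "l > 0" "r \<ge> 0" for l r using ep(3) that by blast
  have f_cont: "continuous_on UNIV (\<lambda>t. f l \<bar>t\<bar>)" if "l > 0" for l using ep(2) that by blast
  have f0: "f l 0 powr m = l powr p" if "l > 0" for l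
    using that m1 by (simp add: init powr_powr p_def)
  have "\<exists>j. profile p d \<beta> (l powr p) (g l) j" if "l > 0" for l
    using ep(1)[OF that] f0[OF that] unfolding g_def[abs_def] by simp
  then obtain j where prof: "\<And>l. l > 0 \<Longrightarrow> profile p d \<beta> (l powr p) (g l) (j l)" by metis
  interpret base: profile p d \<beta> 1 "g 1" "j 1" using prof[of 1] by simp
  define U where "U = base.U"
  \<comment> \<open>The scaled base profile has the same value at the origin, so uniqueness
    identifies the two. The whole family thus becomes one trajectory \<open>U\<close> evaluated at
    \<open>ln r + ln l\<close>.\<close>
  have g_scale: "g l r = l powr p * g 1 (l * r)" if "l > 0" "r > 0" for l r
  proof -
    interpret q: profile p d \<beta> "l powr p" "g l" "j l" using prof that by simp
    show ?thesis using q.unique[of _ _ r] base.scale[OF \<open>l > 0\<close>] that by simp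
  qed
  have U_l: "profile.U p d (g l) s = U (s + ln l)" if "l > 0" for l s
    unfolding U_def using base.U_scaled[OF prof[OF that] that] g_scale that by blast
  have pair: "profile_pair p d \<beta> (l powr p) (l' powr p) (g l) (j l) (g l') (j l')" if "l > 0" "l' > 0" for l l'
    using prof that by (simp add: profile_pair_def)
  have q1: "m * (1 + 2/p) = 1" using m_pos m1 by (simp add: p_def field_simps)
  have gq: "g l r powr (1 + 2/p) = f l r" if "l > 0" "r \<ge> 0" for l r
    using f_pos[OF that] q1 by (simp add: g_def powr_powr)
  have g_less: "g l r < g l' r \<longleftrightarrow> U (ln r + ln l) < U (ln r + ln l')" if "l > 0" "l' > 0" "r > 0" for l l' r
    using profile.U_less_iff[OF prof prof, of l l' "ln r"] that U_l by simp
  have f_less: "f l r < f l' r \<longleftrightarrow> g l r < g l' r" if "l > 0" "l' > 0" "r \<ge> 0" for l l' r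
    unfolding g_def using powr_less_powr_iff[of "f l r" "f l' r" m] f_pos that m_pos by simp
  have f0_less: "f l 0 < f l' 0" if "0 < l" "l < l'" for l l'
    using that m1 by (simp add: init powr_less_mono2)
  have k_eq: "profile_pair.k p d (g l) (g l') r = r ^ (n - 1) * (f l' r - f l r)" if "l > 0" "l' > 0" "r \<ge> 0" for l l' r
  proof -
    interpret pr: profile_pair p d \<beta> "l powr p" "l' powr p" "g l" "j l" "g l'" "j l'" using pair that by simp
    have "r powr (p + d + 1) = r ^ (n - 1)"
    proof (cases "r = 0")
      case False
      have "p + d + 1 = real (n - 1)" using npd n_ge by (simp add: of_nat_diff)
      then show ?thesis using False that powr_realpow[of r "n - 1"] by simp
    qed (use n_ge in simp)
    then show ?thesis using gq that by (simp add: pr.k_def)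
  qed
  have k_cont: "continuous_on {0..} (profile_pair.k p d (g l) (g l'))" if "l > 0" "l' > 0" for l l'
  proof -
    have "continuous_on {0..} (\<lambda>r. r ^ (n - 1) * (f l' \<bar>r\<bar> - f l \<bar>r\<bar>))"
      by (intro continuous_intros continuous_on_subset[OF f_cont]) (use that in auto)
    then show ?thesis using k_eq[OF that] by (subst continuous_on_cong[OF refl]) auto
  qed
  have int_iff: "integrable lborel (\<lambda>y::real^'n. f l' (norm y) - f l (norm y)) \<longleftrightarrow>
      set_integrable lborel {0..} (profile_pair.k p d (g l) (g l'))" if "l > 0" "l' > 0" for l l'
  proof -
    have "integrable lborel (\<lambda>y::real^'n. f l' (norm y) - f l (norm y)) \<longleftrightarrow>
        set_integrable lborel {0..} (\<lambda>r. r ^ (n - 1) * (f l' r - f l r))"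
      using integrable_radial_iff[where h="\<lambda>r. f l' r - f l r" and 'a="real^'n",
          OF continuous_on_diff[OF f_cont[OF that(2)] f_cont[OF that(1)]]] unfolding dim .
    also have "\<dots> \<longleftrightarrow> set_integrable lborel {0..} (profile_pair.k p d (g l) (g l'))"
      by (rule set_integrable_cong) (use k_eq that in auto)
    finally show ?thesis .
  qed
  \<comment> \<open>\<open>k\<close> is the second profile minus the first. In (a) and (c) the
    smaller parameter comes first in the pair, so the sign has to be changed; in (b) the pair is
    taken in reversed order.\<close>
  have int_swap: "integrable lborel (\<lambda>y::real^'n. f l (norm y) - f l' (norm y)) \<longleftrightarrow>
      integrable lborel (\<lambda>y::real^'n. f l' (norm y) - f l (norm y))" for l l'
    using integrable_minus[of lborel "\<lambda>y::real^'n. f l (norm y) - f l' (norm y)"]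
      integrable_minus[of lborel "\<lambda>y::real^'n. f l' (norm y) - f l (norm y)"] by auto
  have U_incr: "U s < U t" if "\<And>s. base.X s > 0" "s < t" for s t
    unfolding U_def by (rule deriv_pos_less[OF that(2) base.du]) (use that in auto)
  have g_incr: "g l r < g l' r" if "\<And>s. base.X s > 0" "0 < l" "l < l'" "0 < r" for l l' r
    unfolding g_less[OF that(2) less_trans[OF that(2,3)] that(4)]
    by (rule U_incr[OF that(1)]) (use that in auto)
  have f_incr: "f l r < f l' r" if "\<And>s. base.X s > 0" "0 < l" "l < l'" "0 \<le> r" for l l' r
    using f_less[of l l' r] g_incr[of l l' r] f0_less[of l l'] that by (cases "r = 0") auto
  show ?thesis
  proof (intro conjI impI)
    assume a: "\<beta> > beta1 n m \<or> (n > 4 \<and> m < (real n - 4) / (real n - 2) \<and> \<beta> \<le> beta1 n m)"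
    have XU: "base.X s > 0 \<and> base.U s < 0" for s
      using a base.monotone_of_b_large base.monotone_of_d_large disc b1_gr par(7) by blast
    then have X: "\<And>s. base.X s > 0" by blast
    show "\<forall>r l\<^sub>1 l\<^sub>2. 0 \<le> r \<and> 0 < l\<^sub>1 \<and> l\<^sub>1 < l\<^sub>2 \<longrightarrow> f l\<^sub>1 r < f l\<^sub>2 r"
      using f_incr[OF X] by blast
    show "\<forall>l\<^sub>1 l\<^sub>2. 0 < l\<^sub>1 \<and> l\<^sub>1 < l\<^sub>2 \<longrightarrow>
           \<not> integrable lborel (\<lambda>y::real^'n. f l\<^sub>1 (norm y) - f l\<^sub>2 (norm y))"
    proof (intro allI impI)
      fix l\<^sub>1 l\<^sub>2 :: real assume l: "0 < l\<^sub>1 \<and> l\<^sub>1 < l\<^sub>2"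
      then have l0: "l\<^sub>1 > 0" "l\<^sub>2 > 0" by auto
      interpret pr: profile_pair p d \<beta> "l\<^sub>1 powr p" "l\<^sub>2 powr p" "g l\<^sub>1" "j l\<^sub>1" "g l\<^sub>2" "j l\<^sub>2"
        by (rule pair[OF l0])
      have "\<not> set_integrable lborel {0..} pr.k"
      \<comment> \<open>\<open>U\<close> increases, so its value at \<open>r = 1\<close> bounds it
        from below for \<open>r \<ge> 1\<close>.\<close>
      proof (rule pr.not_integrable[OF k_cont[OF l0], where cl="U (ln l\<^sub>1)"])
        show "g l\<^sub>1 r < g l\<^sub>2 r" if "r > 0" for r using g_incr[OF X] l that by blast
        show "U (ln l\<^sub>1) \<le> pr.lo.U s" if "s \<ge> 0" for s
          unfolding U_l[OF l0(1)] using U_incr[OF X, of "ln l\<^sub>1" "s + ln l\<^sub>1"] that by (cases "s = 0") auto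
        assume "pr.ga = 0"
        \<comment> \<open>A vanishing \<open>ga\<close> means \<open>\<beta> = beta1 n m\<close>,
          which only the second alternative of the hypothesis allows.\<close>
        then have "\<not> \<beta> > beta1 n m" unfolding b1_gr pr.ga_def by (simp add: field_simps)
        then have "d > 2" using a par(7) by blast
        then show "d > 2 \<and> (\<forall>s. pr.hi.U s \<le> 0)"
          unfolding U_l[OF l0(2)] U_def using XU by (auto intro: less_imp_le)
      qed
      then show "\<not> integrable lborel (\<lambda>y::real^'n. f l\<^sub>1 (norm y) - f l\<^sub>2 (norm y))"
        using int_iff[OF l0] int_swap by blast
    qed
  next
    assume b: "(n \<le> 4 \<and> \<beta> < beta1 n m) \<or> (n > 4 \<and> (real n - 4) / (real n - 2) < m \<and> \<beta> < beta1 n m)"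
    have d2: "d < 2" and bp: "2 * d * \<beta> < p + 2" using b dlt b1_less by auto
    obtain s1 where s1: "\<And>s. s > s1 \<Longrightarrow> base.X s < 0 \<and> base.U s > 0"
      using base.overshoot[OF bp d2 disc] by blast
    have U_decr: "U t < U s" if "s1 < s" "s < t" for s t
    proof -
      have "- U s < - U t" unfolding U_def
        by (rule deriv_pos_less[where F="\<lambda>s. - base.U s", OF that(2) DERIV_minus[OF base.du]]) (use s1 that in auto)
      then show ?thesis by simp
    qed
    define R\<^sub>0 where "R\<^sub>0 = exp (s1 + 1)"
    have R0: "R\<^sub>0 > 0" by (simp add: R\<^sub>0_def)
    \<comment> \<open>The bound \<open>r \<ge> R\<^sub>0 / l\<close> reads
      \<open>ln r + ln l \<ge> s1 + 1\<close>; the summand 1 in \<open>R\<^sub>0\<close> provides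
      the strict inequality that \<open>s1\<close> requires.\<close>
    have large: "ln r + ln l > s1" "r > 0" if "0 < l" "R\<^sub>0 / l \<le> r" for r l
    proof -
      have "R\<^sub>0 / l > 0" using R0 that by simp
      then show r: "r > 0" using that by linarith
      have "ln (R\<^sub>0 / l) \<le> ln r" using that \<open>R\<^sub>0 / l > 0\<close> by (subst ln_le_cancel_iff) (use r in auto)
      then show "ln r + ln l > s1" using R0 that by (simp add: ln_div R\<^sub>0_def)
    qed
    have g_decr: "g l\<^sub>2 r < g l\<^sub>1 r" if "0 < l\<^sub>1" "l\<^sub>1 < l\<^sub>2" "R\<^sub>0 / l\<^sub>1 \<le> r" for r l\<^sub>1 l\<^sub>2
      using g_less[of l\<^sub>2 l\<^sub>1 r] large[OF that(1,3)] that U_decr[of "ln r + ln l\<^sub>1" "ln r + ln l\<^sub>2"] by simp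
    show "\<exists>R\<^sub>0>0. \<forall>r l\<^sub>1 l\<^sub>2. 0 < l\<^sub>1 \<and> l\<^sub>1 < l\<^sub>2 \<and> R\<^sub>0 / l\<^sub>1 \<le> r \<longrightarrow> f l\<^sub>1 r > f l\<^sub>2 r"
    proof (intro exI[of _ R\<^sub>0] conjI R0 allI impI)
      fix r l\<^sub>1 l\<^sub>2 assume *: "0 < l\<^sub>1 \<and> l\<^sub>1 < l\<^sub>2 \<and> R\<^sub>0 / l\<^sub>1 \<le> r"
      then show "f l\<^sub>1 r > f l\<^sub>2 r"
        using f_less[of l\<^sub>2 l\<^sub>1 r] g_decr[of l\<^sub>1 l\<^sub>2 r] large(2)[of l\<^sub>1 r] by simp
    qed
    show "\<forall>l\<^sub>1 l\<^sub>2. 0 < l\<^sub>1 \<and> l\<^sub>1 < l\<^sub>2 \<longrightarrow>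
           integrable lborel (\<lambda>y::real^'n. f l\<^sub>1 (norm y) - f l\<^sub>2 (norm y))"
    proof (intro allI impI)
      fix l\<^sub>1 l\<^sub>2 :: real assume l: "0 < l\<^sub>1 \<and> l\<^sub>1 < l\<^sub>2"
      then have l0: "l\<^sub>2 > 0" "l\<^sub>1 > 0" by auto
      interpret pr: profile_pair p d \<beta> "l\<^sub>2 powr p" "l\<^sub>1 powr p" "g l\<^sub>2" "j l\<^sub>2" "g l\<^sub>1" "j l\<^sub>1"
        by (rule pair[OF l0])
      have "set_integrable lborel {0..} pr.k"
      proof (rule pr.integrable_of_overshoot[OF k_cont[OF l0], where R="R\<^sub>0 / l\<^sub>1"])
        show "pr.ga > 0" using bp by (simp add: pr.ga_def field_simps)
        show "R\<^sub>0 / l\<^sub>1 > 0" using R0 l0 by simp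
        show "g l\<^sub>2 r < g l\<^sub>1 r" if "R\<^sub>0 / l\<^sub>1 \<le> r" for r using g_decr l that by blast
        show "2 * d * \<beta> \<ge> p + d" using base.b_large_of_disc[OF d2 disc] by simp
        fix r assume r: "R\<^sub>0 / l\<^sub>1 \<le> r"
        have "ln l\<^sub>1 < ln l\<^sub>2" using l by simp
        then have "s1 < ln r + ln l\<^sub>2" using large(1)[OF l0(2) r] by linarith
        then show "0 \<le> pr.lo.U (ln r)" unfolding U_l[OF l0(1)] U_def using s1 by (simp add: less_imp_le)
      qed
      then show "integrable lborel (\<lambda>y::real^'n. f l\<^sub>1 (norm y) - f l\<^sub>2 (norm y))"
        using int_iff[OF l0] by blast
    qed
  next
    assume c: "(n \<le> 4 \<and> \<beta> = beta1 n m) \<or> (n > 4 \<and> (real n - 4) / (real n - 2) < m \<and> \<beta> = beta1 n m)"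
    have d2: "d < 2" and bp: "2 * d * \<beta> = p + 2" using c dlt b1_less b1_gr by auto
    have XU: "base.X s > 0 \<and> base.U s < 0" for s using base.explicit_of_b_eq(1)[OF bp] .
    then have X: "\<And>s. base.X s > 0" by blast
    show "\<forall>r l\<^sub>1 l\<^sub>2. 0 \<le> r \<and> 0 < l\<^sub>1 \<and> l\<^sub>1 < l\<^sub>2 \<longrightarrow> f l\<^sub>1 r < f l\<^sub>2 r"
      using f_incr[OF X] by blast
    show "\<forall>l\<^sub>1 l\<^sub>2. 0 < l\<^sub>1 \<and> l\<^sub>1 < l\<^sub>2 \<longrightarrow>
           integrable lborel (\<lambda>y::real^'n. f l\<^sub>1 (norm y) - f l\<^sub>2 (norm y))"
    proof (intro allI impI)
      fix l\<^sub>1 l\<^sub>2 :: real assume l: "0 < l\<^sub>1 \<and> l\<^sub>1 < l\<^sub>2"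
      then have l0: "l\<^sub>1 > 0" "l\<^sub>2 > 0" by auto
      interpret pr: profile_pair p d \<beta> "l\<^sub>1 powr p" "l\<^sub>2 powr p" "g l\<^sub>1" "j l\<^sub>1" "g l\<^sub>2" "j l\<^sub>2"
        by (rule pair[OF l0])
      have "set_integrable lborel {0..} pr.k"
      proof (rule pr.integrable_of_explicit[OF k_cont[OF l0] _ d2])
        show "pr.ga = 0" using bp by (simp add: pr.ga_def field_simps)
        show "g l\<^sub>1 r < g l\<^sub>2 r" if "r > 0" for r using g_incr[OF X] l that by blast
        show "pr.hi.U s \<le> 0" for s unfolding U_l[OF l0(2)] U_def using XU by (simp add: less_imp_le)
        have "filterlim (\<lambda>s. ln l\<^sub>1 + s) at_top at_top"
          by (rule filterlim_tendsto_add_at_top[OF tendsto_const filterlim_ident])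
        then have "filterlim (\<lambda>s. s + ln l\<^sub>1) at_top at_top" by (simp only: add.commute)
        then have "((\<lambda>s. U (s + ln l\<^sub>1)) \<longlongrightarrow> 0) at_top"
          unfolding U_def by (rule filterlim_compose[OF base.explicit_of_b_eq(2)[OF bp]])
        then show "(pr.lo.U \<longlongrightarrow> 0) at_top" unfolding U_l[OF l0(1), abs_def] .
      qed
      then show "integrable lborel (\<lambda>y::real^'n. f l\<^sub>1 (norm y) - f l\<^sub>2 (norm y))"
        using int_iff[OF l0] int_swap by blast
    qed
  qed
qed

end
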